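(* There is a polynomial-time algorithm which, given an SMC instance $\mathcal I$ with an optimal matching $\mu^{\mathrm{opt}}$, computes a stable integral matching $\mu$ such that - $\mathcal W(\mu)\ge\min\{\tfrac12,\tfrac1\alpha\}\,\mathcal W(\mu^{\mathrm{opt}})$ if $\mathcal I$ has ternary valuations in $\{0,1,\alpha\}$, and - $\mathcal W(\mu)\ge\left(1+\sigma_{\max}/\sigma_{\min}\right)^{-1}\mathcal W(\mu^{\mathrm{opt}})$ in general, where $\sigma_{\max}$ and $\sigma_{\min}$ denote the highest and lowest non-zero valuation in $\mathcal I$, respectively.
   Context: An SMC instance is a tuple $\langle M,W,U,V\rangle$ with $n$ men $M$, $n$ women $W$, and $n\times n$ matrices $U,V$ of non-negative rational numbers; $U(m,w)$ is the value of man $m$ for woman $w$ and $V(m,w)$ is the value of woman $w$ for man $m$. Ternary valuations in $\{0,1,\alpha\}$ (with $\alpha>1$) means $U,V\in\{0,1,\alpha\}^{n\times n}$. The quantities $\sigma_{\max},\sigma_{\min}$ range over all non-zero entries of $U$ and $V$ (and are meaningful when there is at least one). A fractional matching is $\mu:M\times W\to\mathbb R_{\ge0}$ with $\sum_w\mu(m,w)\le1$ for all $m$ and $\sum_m\mu(m,w)\le1$ for all $w$; it is complete if all these hold with equality, and integral if all values lie in $\{0,1\}$. Unless stated otherwise, matchings are assumed complete. Utilities: $u_m(\mu)=\sum_w U(m,w)\mu(m,w)$, $v_w(\mu)=\sum_m V(m,w)\mu(m,w)$. The matching $\mu$ is stable if for every $(m,w)\in M\times W$, $u_m(\mu)\ge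 U(m,w)$ or $v_w(\mu)\ge V(m,w)$. Social welfare: $\mathcal W(\mu)=\sum_m u_m(\mu)+\sum_w v_w(\mu)$. An optimal matching is one maximizing $\mathcal W$ among all (not necessarily stable) fractional matchings. *)

theory Defs
  imports Complex_Main "HOL-Library.Log_Nat" "HOL-Computational_Algebra.Polynomial"
begin

section \<open>Matchings with cardinal preferences\<close>

text \<open>
  An instance consists of \<open>n\<close> men and \<open>n\<close> women, both numbered \<open>0, \<dots>, n - 1\<close>, and the valuation
  matrices \<open>U\<close> and \<open>V\<close>, both indexed by (man, woman).  Only the entries with both indices below
  \<open>n\<close> are part of the instance.
\<close>

definition smc_instance :: "nat \<Rightarrow> (nat \<Rightarrow> nat \<Rightarrow> rat) \<Rightarrow> (nat \<Rightarrow> nat \<Rightarrow> rat) \<Rightarrow> bool" where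
  "smc_instance n U V \<longleftrightarrow> (\<forall>m<n. \<forall>w<n. 0 \<le> U m w \<and> 0 \<le> V m w)"

definition ternary_valuations ::
  "real \<Rightarrow> nat \<Rightarrow> (nat \<Rightarrow> nat \<Rightarrow> rat) \<Rightarrow> (nat \<Rightarrow> nat \<Rightarrow> rat) \<Rightarrow> bool" where
  "ternary_valuations \<alpha> n U V \<longleftrightarrow>
     (\<forall>m<n. \<forall>w<n. real_of_rat (U m w) \<in> {0, 1, \<alpha>} \<and> real_of_rat (V m w) \<in> {0, 1, \<alpha>})"

definition nonzero_valuations ::
  "nat \<Rightarrow> (nat \<Rightarrow> nat \<Rightarrow> rat) \<Rightarrow> (nat \<Rightarrow> nat \<Rightarrow> rat) \<Rightarrow> rat set" where
  "nonzero_valuations n U V = {x. x \<noteq> 0 \<and> (\<exists>m<n. \<exists>w<n. x = U m w \<or> x = V m w)}"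

definition sigma_max :: "nat \<Rightarrow> (nat \<Rightarrow> nat \<Rightarrow> rat) \<Rightarrow> (nat \<Rightarrow> nat \<Rightarrow> rat) \<Rightarrow> rat" where
  "sigma_max n U V = Max (nonzero_valuations n U V)"

definition sigma_min :: "nat \<Rightarrow> (nat \<Rightarrow> nat \<Rightarrow> rat) \<Rightarrow> (nat \<Rightarrow> nat \<Rightarrow> rat) \<Rightarrow> rat" where
  "sigma_min n U V = Min (nonzero_valuations n U V)"

definition fractional_matching :: "nat \<Rightarrow> (nat \<Rightarrow> nat \<Rightarrow> real) \<Rightarrow> bool" where
  "fractional_matching n \<mu> \<longleftrightarrow>
     (\<forall>m<n. \<forall>w<n. 0 \<le> \<mu> m w) \<and>
     (\<forall>m<n. (\<Sum>w<n. \<mu> m w) \<le> 1) \<and>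
     (\<forall>w<n. (\<Sum>m<n. \<mu> m w) \<le> 1)"

definition complete_matching :: "nat \<Rightarrow> (nat \<Rightarrow> nat \<Rightarrow> real) \<Rightarrow> bool" where
  "complete_matching n \<mu> \<longleftrightarrow>
     fractional_matching n \<mu> \<and>
     (\<forall>m<n. (\<Sum>w<n. \<mu> m w) = 1) \<and>
     (\<forall>w<n. (\<Sum>m<n. \<mu> m w) = 1)"

definition integral_matching :: "nat \<Rightarrow> (nat \<Rightarrow> nat \<Rightarrow> real) \<Rightarrow> bool" where
  "integral_matching n \<mu> \<longleftrightarrow> (\<forall>m<n. \<forall>w<n. \<mu> m w \<in> {0, 1})"

definition man_utility ::
  "nat \<Rightarrow> (nat \<Rightarrow> nat \<Rightarrow> rat) \<Rightarrow> (nat \<Rightarrow> nat \<Rightarrow> real) \<Rightarrow> nat \<Rightarrow> real" where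
  "man_utility n U \<mu> m = (\<Sum>w<n. real_of_rat (U m w) * \<mu> m w)"

definition woman_utility ::
  "nat \<Rightarrow> (nat \<Rightarrow> nat \<Rightarrow> rat) \<Rightarrow> (nat \<Rightarrow> nat \<Rightarrow> real) \<Rightarrow> nat \<Rightarrow> real" where
  "woman_utility n V \<mu> w = (\<Sum>m<n. real_of_rat (V m w) * \<mu> m w)"

definition stable_matching ::
  "nat \<Rightarrow> (nat \<Rightarrow> nat \<Rightarrow> rat) \<Rightarrow> (nat \<Rightarrow> nat \<Rightarrow> rat) \<Rightarrow> (nat \<Rightarrow> nat \<Rightarrow> real) \<Rightarrow> bool" where
  "stable_matching n U V \<mu> \<longleftrightarrow>
     (\<forall>m<n. \<forall>w<n. man_utility n U \<mu> m \<ge> real_of_rat (U m w)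
                 \<or> woman_utility n V \<mu> w \<ge> real_of_rat (V m w))"

definition welfare ::
  "nat \<Rightarrow> (nat \<Rightarrow> nat \<Rightarrow> rat) \<Rightarrow> (nat \<Rightarrow> nat \<Rightarrow> rat) \<Rightarrow> (nat \<Rightarrow> nat \<Rightarrow> real) \<Rightarrow> real" where
  "welfare n U V \<mu> = (\<Sum>m<n. man_utility n U \<mu> m) + (\<Sum>w<n. woman_utility n V \<mu> w)"

definition optimal_matching ::
  "nat \<Rightarrow> (nat \<Rightarrow> nat \<Rightarrow> rat) \<Rightarrow> (nat \<Rightarrow> nat \<Rightarrow> rat) \<Rightarrow> (nat \<Rightarrow> nat \<Rightarrow> real) \<Rightarrow> bool" where
  "optimal_matching n U V \<mu> \<longleftrightarrow>
     complete_matching n \<mu> \<and>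
     (\<forall>\<mu>'. complete_matching n \<mu>' \<longrightarrow> welfare n U V \<mu>' \<le> welfare n U V \<mu>)"


section \<open>Algorithms and their running time\<close>

text \<open>
  Algorithms are programs of a first-order, call-by-value functional language with recursion.  Its
  data are binary trees with integer leaves.  The cost model is logarithmic: an arithmetic operation
  or comparison is charged the product of the bit lengths of its operands, which is enough for
  schoolbook arithmetic (including multiplication and division); every other step is a constant
  number of pointer operations and is charged one unit.  No primitive inspects or copies a whole
  tree, so unit cost is justified by an implementation that shares subtrees.  Up to a polynomial,
  this is the running time on a logarithmic-cost RAM or a Turing machine, provided that, as for
  the 0/1 matrices below, the output, written out as a tree, has polynomial size.
\<close>

datatype val = IntV int | PairV val val

datatype arith = Add | Sub | Mul | Div

datatype exp =
    Var nat
  | Const int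
  | Arith arith exp exp
  | IfLess exp exp exp exp
  | MkPair exp exp
  | Fst exp
  | Snd exp
  | IfPair exp exp exp
  | LetIn exp exp
  | Call nat "exp list"

text \<open>
  A program is the list of its function bodies.  In a body, \<open>Var i\<close> is the \<open>i\<close>-th argument;
  \<open>LetIn a b\<close> binds the value of \<open>a\<close> to \<open>Var 0\<close> in \<open>b\<close> and shifts the other variables by one.
\<close>

type_synonym program = "exp list"

definition int_size :: "int \<Rightarrow> nat" where
  "int_size i = 1 + floorlog 2 (nat \<bar>i\<bar>)"

fun arith_op :: "arith \<Rightarrow> int \<Rightarrow> int \<Rightarrow> int" where
  "arith_op Add i j = i + j"
| "arith_op Sub i j = i - j"
| "arith_op Mul i j = i * j"
| "arith_op Div i j = i div j"

text \<open>
  \<open>eval P \<rho> e v t\<close>: in the environment \<open>\<rho>\<close>, the expression \<open>e\<close> evaluates to \<open>v\<close> in time \<open>t\<close>.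
  There is no such \<open>v\<close> and \<open>t\<close> if the evaluation diverges or gets stuck.
\<close>

inductive eval :: "program \<Rightarrow> val list \<Rightarrow> exp \<Rightarrow> val \<Rightarrow> nat \<Rightarrow> bool"
  and evals :: "program \<Rightarrow> val list \<Rightarrow> exp list \<Rightarrow> val list \<Rightarrow> nat \<Rightarrow> bool"
  for P :: program
where
  eval_Var: "i < length \<rho> \<Longrightarrow> eval P \<rho> (Var i) (\<rho> ! i) 1"
| eval_Const: "eval P \<rho> (Const i) (IntV i) 1"
| eval_Arith:
    "eval P \<rho> a (IntV i) s \<Longrightarrow> eval P \<rho> b (IntV j) t \<Longrightarrow>
     eval P \<rho> (Arith f a b) (IntV (arith_op f i j)) (s + t + int_size i * int_size j)"
| eval_IfLess_True:
    "i < j \<Longrightarrow> eval P \<rho> a (IntV i) r \<Longrightarrow> eval P \<rho> b (IntV j) s \<Longrightarrow> eval P \<rho> c v t \<Longrightarrow>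
     eval P \<rho> (IfLess a b c d) v (r + s + t + int_size i * int_size j)"
| eval_IfLess_False:
    "\<not> i < j \<Longrightarrow> eval P \<rho> a (IntV i) r \<Longrightarrow> eval P \<rho> b (IntV j) s \<Longrightarrow> eval P \<rho> d v t \<Longrightarrow>
     eval P \<rho> (IfLess a b c d) v (r + s + t + int_size i * int_size j)"
| eval_MkPair:
    "eval P \<rho> a v s \<Longrightarrow> eval P \<rho> b w t \<Longrightarrow> eval P \<rho> (MkPair a b) (PairV v w) (s + t + 1)"
| eval_Fst: "eval P \<rho> a (PairV v w) t \<Longrightarrow> eval P \<rho> (Fst a) v (t + 1)"
| eval_Snd: "eval P \<rho> a (PairV v w) t \<Longrightarrow> eval P \<rho> (Snd a) w (t + 1)"
| eval_IfPair_True: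
    "eval P \<rho> a (PairV x y) s \<Longrightarrow> eval P \<rho> b v t \<Longrightarrow> eval P \<rho> (IfPair a b c) v (s + t + 1)"
| eval_IfPair_False:
    "eval P \<rho> a (IntV i) s \<Longrightarrow> eval P \<rho> c v t \<Longrightarrow> eval P \<rho> (IfPair a b c) v (s + t + 1)"
| eval_LetIn:
    "eval P \<rho> a v s \<Longrightarrow> eval P (v # \<rho>) b w t \<Longrightarrow> eval P \<rho> (LetIn a b) w (s + t + 1)"
| eval_Call:
    "evals P \<rho> es vs s \<Longrightarrow> f < length P \<Longrightarrow> eval P vs (P ! f) v t \<Longrightarrow>
     eval P \<rho> (Call f es) v (s + t + 1)"
| evals_Nil: "evals P \<rho> [] [] 0"
| evals_Cons:
    "eval P \<rho> e v s \<Longrightarrow> evals P \<rho> es vs t \<Longrightarrow> evals P \<rho> (e # es) (v # vs) (s + t)"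

inductive_cases eval_VarE: "eval P \<rho> (Var i) v t"
inductive_cases eval_ConstE: "eval P \<rho> (Const i) v t"
inductive_cases eval_ArithE: "eval P \<rho> (Arith f a b) v t"
inductive_cases eval_IfLessE: "eval P \<rho> (IfLess a b c d) v t"
inductive_cases eval_MkPairE: "eval P \<rho> (MkPair a b) v t"
inductive_cases eval_FstE: "eval P \<rho> (Fst a) v t"
inductive_cases eval_SndE: "eval P \<rho> (Snd a) v t"
inductive_cases eval_IfPairE: "eval P \<rho> (IfPair a b c) v t"
inductive_cases eval_LetInE: "eval P \<rho> (LetIn a b) v t"
inductive_cases eval_CallE: "eval P \<rho> (Call f es) v t"
inductive_cases evals_NilE: "evals P \<rho> [] vs t"
inductive_cases evals_ConsE: "evals P \<rho> (e # es) vs t"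

lemma eval_deterministic:
  "eval P \<rho> e v t \<Longrightarrow> eval P \<rho> e v' t' \<Longrightarrow> v' = v \<and> t' = t"
  and evals_deterministic:
  "evals P \<rho> es vs t \<Longrightarrow> evals P \<rho> es vs' t' \<Longrightarrow> vs' = vs \<and> t' = t"
proof (induction arbitrary: v' t' and vs' t' rule: eval_evals.inducts)
  case eval_Var then show ?case by (auto elim: eval_VarE)
next
  case eval_Const then show ?case by (auto elim: eval_ConstE)
next
  case eval_Arith from eval_Arith.prems show ?case
    by (rule eval_ArithE) (auto dest!: eval_Arith.IH(2,4))
next
  case eval_IfLess_True from eval_IfLess_True.prems show ?case
    by (rule eval_IfLessE) (use eval_IfLess_True.hyps in \<open>auto dest!: eval_IfLess_True.IH(2,4,6)\<close>)
next
  case eval_IfLess_False from eval_IfLess_False.prems show ?case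
    by (rule eval_IfLessE) (use eval_IfLess_False.hyps in \<open>auto dest!: eval_IfLess_False.IH(2,4,6)\<close>)
next
  case eval_MkPair from eval_MkPair.prems show ?case
    by (rule eval_MkPairE) (auto dest!: eval_MkPair.IH(2,4))
next
  case eval_Fst from eval_Fst.prems show ?case
    by (rule eval_FstE) (auto dest!: eval_Fst.IH(2))
next
  case eval_Snd from eval_Snd.prems show ?case
    by (rule eval_SndE) (auto dest!: eval_Snd.IH(2))
next
  case eval_IfPair_True from eval_IfPair_True.prems show ?case
    by (rule eval_IfPairE) (auto dest!: eval_IfPair_True.IH(2,4))
next
  case eval_IfPair_False from eval_IfPair_False.prems show ?case
    by (rule eval_IfPairE) (auto dest!: eval_IfPair_False.IH(2,4))
next
  case eval_LetIn from eval_LetIn.prems show ?case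
    by (rule eval_LetInE) (auto dest!: eval_LetIn.IH(2,4))
next
  case eval_Call from eval_Call.prems show ?case
    by (rule eval_CallE) (auto dest!: eval_Call.IH(2,5))
next
  case evals_Nil then show ?case by (auto elim: evals_NilE)
next
  case evals_Cons from evals_Cons.prems show ?case
    by (rule evals_ConsE) (auto dest!: evals_Cons.IH(2,4))
qed

definition runs :: "program \<Rightarrow> val \<Rightarrow> val \<Rightarrow> nat \<Rightarrow> bool" where
  "runs P x y t \<longleftrightarrow> eval P [x] (Call 0 [Var 0]) y t"

fun val_size :: "val \<Rightarrow> nat" where
  "val_size (IntV i) = int_size i"
| "val_size (PairV v w) = 1 + val_size v + val_size w"

text \<open>
  \<open>poly_time_solves P inp out D R\<close>: there is a polynomial \<open>p\<close> such that, on every input \<open>x\<close>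
  from the domain \<open>D\<close>, given in the encoding \<open>inp\<close>, the program \<open>P\<close> halts within \<open>p\<close> of the size of
  the encoded input and returns the encoding of some \<open>y\<close> with \<open>R x y\<close>.  The encoding \<open>out\<close> of the
  output may depend on \<open>x\<close>, as it does for matrices, whose dimension is that of the instance.
\<close>

definition poly_time_solves ::
  "program \<Rightarrow> ('a \<Rightarrow> val) \<Rightarrow> ('a \<Rightarrow> 'b \<Rightarrow> val) \<Rightarrow> ('a \<Rightarrow> bool) \<Rightarrow> ('a \<Rightarrow> 'b \<Rightarrow> bool) \<Rightarrow> bool" where
  "poly_time_solves P inp out D R \<longleftrightarrow>
     (\<exists>p :: nat poly. \<forall>x. D x \<longrightarrow>
        (\<exists>y t. runs P (inp x) (out x y) t \<and> t \<le> poly p (val_size (inp x)) \<and> R x y))"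


section \<open>Encoding of instances and matchings\<close>

definition encode_rat :: "rat \<Rightarrow> val" where
  "encode_rat q = PairV (IntV (fst (quotient_of q))) (IntV (snd (quotient_of q)))"

definition encode_list :: "val list \<Rightarrow> val" where
  "encode_list vs = foldr PairV vs (IntV 0)"

definition encode_matrix :: "nat \<Rightarrow> (nat \<Rightarrow> nat \<Rightarrow> rat) \<Rightarrow> val" where
  "encode_matrix n A =
     encode_list (map (\<lambda>i. encode_list (map (\<lambda>j. encode_rat (A i j)) [0..<n])) [0..<n])"

definition encode_instance ::
  "nat \<Rightarrow> (nat \<Rightarrow> nat \<Rightarrow> rat) \<Rightarrow> (nat \<Rightarrow> nat \<Rightarrow> rat) \<Rightarrow> val" where
  "encode_instance n U V = PairV (IntV (int n)) (PairV (encode_matrix n U) (encode_matrix n V))"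

end

theory Submission
  imports Defs
begin

text \<open>
  Run Gale--Shapley with modified preferences.  Call a pair \<^emph>\<open>mutual\<close> if both members value it
  positively.  Everyone ranks mutual pairs above all others, mutual pairs by own value and then by
  the partner's value, and the other pairs by the sum of the two values.  Only mutual pairs can
  block, so the result \<open>\<mu>\<close> is stable.

  For the welfare, give every agent a price such that each pair is paid for by its two members; the
  sum of the prices then bounds the welfare of every fractional matching.  An agent of value \<open>a\<close>
  whose partner has value \<open>b\<close> gets the price \<open>(1 + \<rho>) a\<close>, where \<open>\<rho>\<close> is the ratio of the largest and
  the smallest non-zero valuation, if the pair is mutual and \<open>a + b\<close> otherwise.  For ternary valuations the price is \<open>a + b\<close>, except that it is \<open>max {2, \<alpha>}\<close> if
  \<open>a = b = 1\<close>.  A pair is paid for by whichever member does not prefer it to \<open>\<mu>\<close>.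
\<close>

section \<open>Prices and welfare\<close>

text \<open>
  The strict preference of an agent valuing the old and new partners \<open>a\<close> and \<open>a'\<close>, who value the
  agent \<open>b\<close> and \<open>b'\<close>.  The tie-break by \<open>b\<close> matters only for the bound \<open>min {1/2, 1/\<alpha>}\<close>.
\<close>

definition worse :: "'a::linordered_field \<Rightarrow> 'a \<Rightarrow> 'a \<Rightarrow> 'a \<Rightarrow> bool" where
  "worse a b a' b' \<longleftrightarrow>
     (if 0 < a \<and> 0 < b then 0 < a' \<and> 0 < b' \<and> (a < a' \<or> a = a' \<and> b < b')
      else 0 < a' \<and> 0 < b' \<or> a + b < a' + b')"

lemma worse_asym: "worse a b a' b' \<Longrightarrow> \<not> worse a' b' a b"
  unfolding worse_def by (auto split: if_splits)

text \<open>Pairs are ranked by whether they are mutual, then lexicographically by own and partner's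
  value among mutual pairs, and by the sum among the others. This is a total preorder, so the
  negation of its strict part is transitive.\<close>

lemma not_worse_trans:
  assumes "\<not> worse a b a' b'" "\<not> worse a' b' a'' b''"
  shows "\<not> worse a b a'' b''"
proof (cases "0 < a \<and> 0 < b"; cases "0 < a' \<and> 0 < b'"; cases "0 < a'' \<and> 0 < b''")
qed (use assms in \<open>auto simp: worse_def\<close>)

text \<open>The program compares rationals, whereas the price argument works over the reals.\<close>

lemma worse_of_rat:
  "worse (real_of_rat a) (real_of_rat b) (real_of_rat a') (real_of_rat b') = worse a b a' b'"
  unfolding worse_def by (simp add: of_rat_less flip: of_rat_add)

text \<open>Weak duality for the assignment problem: \<open>p\<close> and \<open>q\<close> form a
  feasible dual solution, and unit row and column sums turn the weighted prices into plain
  sums.\<close>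

lemma welfare_le_prices:
  assumes "complete_matching n \<nu>"
    and cover: "\<And>m w. m < n \<Longrightarrow> w < n \<Longrightarrow> real_of_rat (U m w) + real_of_rat (V m w) \<le> p m + q w"
  shows "welfare n U V \<nu> \<le> (\<Sum>m<n. p m) + (\<Sum>w<n. q w)"
proof -
  have nonneg: "\<And>m w. m < n \<Longrightarrow> w < n \<Longrightarrow> 0 \<le> \<nu> m w"
    and row: "\<And>m. m < n \<Longrightarrow> (\<Sum>w<n. \<nu> m w) = 1" and col: "\<And>w. w < n \<Longrightarrow> (\<Sum>m<n. \<nu> m w) = 1"
    using assms(1) unfolding complete_matching_def fractional_matching_def by auto
  have "welfare n U V \<nu> = (\<Sum>m<n. \<Sum>w<n. (real_of_rat (U m w) + real_of_rat (V m w)) * \<nu> m w)"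
    unfolding welfare_def man_utility_def woman_utility_def
    by (subst (2) sum.swap) (simp add: sum.distrib distrib_right)
  also have "\<dots> \<le> (\<Sum>m<n. \<Sum>w<n. (p m + q w) * \<nu> m w)"
    by (intro sum_mono mult_right_mono cover nonneg) auto
  also have "\<dots> = (\<Sum>m<n. p m * (\<Sum>w<n. \<nu> m w)) + (\<Sum>w<n. q w * (\<Sum>m<n. \<nu> m w))"
    by (simp add: sum_distrib_left sum.distrib distrib_right) (rule sum.swap)
  also have "\<dots> = (\<Sum>m<n. p m) + (\<Sum>w<n. q w)"
    using row col by simp
  finally show ?thesis .
qed

section \<open>Matchings given by a permutation\<close>

definition perm_matrix :: "(nat \<Rightarrow> nat) \<Rightarrow> nat \<Rightarrow> nat \<Rightarrow> rat" where
  "perm_matrix \<sigma> m w = (if \<sigma> m = w then 1 else 0)"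

text \<open>\<open>unblocked\<close> is stability in the order \<open>worse\<close>, where each side
  puts its own value first.\<close>

locale stable_permutation =
  fixes n :: nat and U V :: "nat \<Rightarrow> nat \<Rightarrow> rat" and \<sigma> \<tau> :: "nat \<Rightarrow> nat"
  assumes instance_ok: "smc_instance n U V"
    and range: "m < n \<Longrightarrow> \<sigma> m < n" "w < n \<Longrightarrow> \<tau> w < n"
    and inverse: "m < n \<Longrightarrow> \<tau> (\<sigma> m) = m" "w < n \<Longrightarrow> \<sigma> (\<tau> w) = w"
    and unblocked: "m < n \<Longrightarrow> w < n \<Longrightarrow>
      \<not> worse (U m (\<sigma> m)) (V m (\<sigma> m)) (U m w) (V m w) \<or>
      \<not> worse (V (\<tau> w) w) (U (\<tau> w) w) (V m w) (U m w)"
begin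

abbreviation "\<mu> \<equiv> (\<lambda>m w. real_of_rat (perm_matrix \<sigma> m w))"

lemma column: "m < n \<Longrightarrow> w < n \<Longrightarrow> \<mu> m w = (if m = \<tau> w then 1 else 0)"
  using inverse by (auto simp: perm_matrix_def)

lemma row: "\<mu> m w = (if w = \<sigma> m then 1 else 0)"
  by (auto simp: perm_matrix_def)

lemma man_utility: "m < n \<Longrightarrow> man_utility n U \<mu> m = real_of_rat (U m (\<sigma> m))"
  using range by (simp add: man_utility_def row if_distrib cong: if_cong)

lemma woman_utility: "w < n \<Longrightarrow> woman_utility n V \<mu> w = real_of_rat (V (\<tau> w) w)"
proof -
  assume w: "w < n"
  have "woman_utility n V \<mu> w = (\<Sum>m<n. if m = \<tau> w then real_of_rat (V m w) else 0)"
    unfolding woman_utility_def by (rule sum.cong) (auto simp: column w)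
  then show ?thesis using range w by simp
qed

lemma complete: "complete_matching n \<mu>"
proof -
  have "(\<Sum>w<n. \<mu> m w) = 1" if "m < n" for m
    using range that by (simp add: row)
  moreover have "(\<Sum>m<n. \<mu> m w) = 1" if "w < n" for w
  proof -
    have "(\<Sum>m<n. \<mu> m w) = (\<Sum>m<n. if m = \<tau> w then 1 else 0)"
      by (rule sum.cong) (auto simp: column that)
    then show ?thesis using range that by simp
  qed
  ultimately show ?thesis
    by (simp add: complete_matching_def fractional_matching_def row)
qed

lemma integral: "integral_matching n \<mu>"
  by (simp add: integral_matching_def row)

text \<open>A pair that strictly improves both values is mutual, since the values it exceeds are
  non-negative. Both members then also prefer it in the order \<open>worse\<close>, which
  \<open>unblocked\<close> rules out.\<close>

lemma stable: "stable_matching n U V \<mu>"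
  unfolding stable_matching_def
proof (intro allI impI)
  fix m w assume mw: "m < n" "w < n"
  have nn: "0 \<le> U m w" "0 \<le> V m w" "0 \<le> U m (\<sigma> m)" "0 \<le> V (\<tau> w) w"
    using instance_ok mw range by (auto simp: smc_instance_def)
  have "U m w \<le> U m (\<sigma> m) \<or> V m w \<le> V (\<tau> w) w"
    using unblocked[OF mw] nn by (auto simp: worse_def split: if_splits)
  then show "real_of_rat (U m w) \<le> man_utility n U \<mu> m \<or>
    real_of_rat (V m w) \<le> woman_utility n V \<mu> w"
    by (simp add: man_utility woman_utility mw of_rat_less_eq)
qed

lemma reindex: "(\<Sum>w<n. f w) = (\<Sum>m<n. f (\<sigma> m))" for f :: "nat \<Rightarrow> real"
  by (rule sum.reindex_bij_witness[where i = \<sigma> and j = \<tau>]) (use range inverse in auto)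

lemma welfare:
  "welfare n U V \<mu> = (\<Sum>m<n. real_of_rat (U m (\<sigma> m)) + real_of_rat (V m (\<sigma> m)))"
proof -
  have "(\<Sum>w<n. woman_utility n V \<mu> w) = (\<Sum>m<n. real_of_rat (V m (\<sigma> m)))"
    by (subst reindex, rule sum.cong) (use range inverse in \<open>auto simp: woman_utility\<close>)
  moreover have "(\<Sum>m<n. man_utility n U \<mu> m) = (\<Sum>m<n. real_of_rat (U m (\<sigma> m)))"
    by (rule sum.cong) (auto simp: man_utility)
  ultimately show ?thesis by (simp add: welfare_def sum.distrib)
qed

text \<open>
  \<open>\<pi> a b\<close> is the price of an agent matched at own value \<open>a\<close> and partner's value \<open>b\<close>: by \<open>cover\<close> it
  pays for every pair that the agent does not prefer, hence one side of each pair pays for it.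
\<close>

lemma welfare_ratio:
  fixes \<pi> :: "real \<Rightarrow> real \<Rightarrow> real" and S :: "real set"
  assumes "complete_matching n \<nu>"
    and S: "\<And>m w. m < n \<Longrightarrow> w < n \<Longrightarrow> real_of_rat (U m w) \<in> S \<and> real_of_rat (V m w) \<in> S"
    and nonneg: "\<And>a b. a \<in> S \<Longrightarrow> b \<in> S \<Longrightarrow> 0 \<le> \<pi> a b"
    and cover: "\<And>a b x y. {a, b, x, y} \<subseteq> S \<Longrightarrow> \<not> worse a b x y \<Longrightarrow> x + y \<le> \<pi> a b"
    and budget: "\<And>a b. a \<in> S \<Longrightarrow> b \<in> S \<Longrightarrow> \<pi> a b + \<pi> b a \<le> c * (a + b)"
  shows "welfare n U V \<nu> \<le> c * welfare n U V \<mu>"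
proof -
  define u v where "u m w = real_of_rat (U m w)" and "v m w = real_of_rat (V m w)" for m w
  have uvS: "u m w \<in> S" "v m w \<in> S" if "m < n" "w < n" for m w
    using S that by (auto simp: u_def v_def)
  define p where "p m = \<pi> (u m (\<sigma> m)) (v m (\<sigma> m))" for m
  define q where "q w = \<pi> (v (\<tau> w) w) (u (\<tau> w) w)" for w
  have "welfare n U V \<nu> \<le> (\<Sum>m<n. p m) + (\<Sum>w<n. q w)"
  proof (rule welfare_le_prices[OF assms(1)])
    fix m w assume mw: "m < n" "w < n"
    have "0 \<le> p m" "0 \<le> q w"
      using mw range by (auto simp: p_def q_def intro!: nonneg uvS)
    moreover have "u m w + v m w \<le> p m" if "\<not> worse (u m (\<sigma> m)) (v m (\<sigma> m)) (u m w) (v m w)"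
      unfolding p_def by (rule cover) (use that mw range in \<open>auto intro!: uvS\<close>)
    moreover have "v m w + u m w \<le> q w" if "\<not> worse (v (\<tau> w) w) (u (\<tau> w) w) (v m w) (u m w)"
      unfolding q_def by (rule cover) (use that mw range in \<open>auto intro!: uvS\<close>)
    ultimately show "real_of_rat (U m w) + real_of_rat (V m w) \<le> p m + q w"
      using unblocked[OF mw] unfolding u_def v_def worse_of_rat by fastforce
  qed
  \<comment> \<open>Summing \<open>q\<close> along \<open>\<sigma>\<close> collects the two prices
    of each matched pair in one term.\<close>
  also have "\<dots> = (\<Sum>m<n. \<pi> (u m (\<sigma> m)) (v m (\<sigma> m)) + \<pi> (v m (\<sigma> m)) (u m (\<sigma> m)))"
    unfolding reindex[of q] sum.distrib by (auto simp: p_def q_def inverse intro!: sum.cong)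
  also have "\<dots> \<le> (\<Sum>m<n. c * (u m (\<sigma> m) + v m (\<sigma> m)))"
    by (rule sum_mono, rule budget) (use range in \<open>auto intro!: uvS\<close>)
  also have "\<dots> = c * welfare n U V \<mu>"
    by (simp add: welfare u_def v_def sum_distrib_left)
  finally show ?thesis .
qed

text \<open>The price \<open>a + b\<close> can be too low only at a match with
  \<open>a = b = 1\<close>, where a non-mutual pair worth \<open>\<alpha>\<close> may fail to be
  preferred. The tie-break by the partner's value makes such an agent prefer a pair with own value 1
  and partner's value \<open>\<alpha>\<close>, so that one need not be paid for.\<close>

lemma ternary_ratio:
  assumes "complete_matching n \<nu>" and \<alpha>: "1 < \<alpha>" and tern: "ternary_valuations \<alpha> n U V"
  shows "min (1 / 2) (1 / \<alpha>) * welfare n U V \<nu> \<le> welfare n U V \<mu>"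
proof -
  define \<pi> :: "real \<Rightarrow> real \<Rightarrow> real" where
    "\<pi> a b = (if a = 1 \<and> b = 1 then max 2 \<alpha> else a + b)" for a b
  have "welfare n U V \<nu> \<le> max 2 \<alpha> * welfare n U V \<mu>"
  proof (rule welfare_ratio[OF assms(1), where S = "{0, 1, \<alpha>}" and \<pi> = \<pi>])
    show "real_of_rat (U m w) \<in> {0, 1, \<alpha>} \<and> real_of_rat (V m w) \<in> {0, 1, \<alpha>}"
      if "m < n" "w < n" for m w
      using tern that by (auto simp: ternary_valuations_def)
    show "0 \<le> \<pi> a b" if "a \<in> {0, 1, \<alpha>}" "b \<in> {0, 1, \<alpha>}" for a b
      using that \<alpha> by (auto simp: \<pi>_def)
    show "x + y \<le> \<pi> a b" if "{a, b, x, y} \<subseteq> {0, 1, \<alpha>}" "\<not> worse a b x y" for a b x y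
      using that \<alpha> by (auto simp: \<pi>_def worse_def)
    show "\<pi> a b + \<pi> b a \<le> max 2 \<alpha> * (a + b)" if "a \<in> {0, 1, \<alpha>}" "b \<in> {0, 1, \<alpha>}" for a b
    proof -
      \<comment> \<open>This is the budget unless \<open>a = b = 1\<close>; there both sides are
        \<open>2 * max 2 \<alpha>\<close>.\<close>
      have "2 * (a + b) \<le> max 2 \<alpha> * (a + b)"
        using that \<alpha> by (intro mult_right_mono) auto
      then show ?thesis by (auto simp: \<pi>_def)
    qed
  qed
  then have "inverse (max 2 \<alpha>) * welfare n U V \<nu> \<le> welfare n U V \<mu>"
    by (simp add: field_simps less_max_iff_disj)
  moreover have "min (1 / 2) (1 / \<alpha>) = inverse (max 2 \<alpha>)"
    using \<alpha> by (auto simp: min_def max_def field_simps)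
  ultimately show ?thesis by simp
qed

text \<open>No valuation exceeds \<open>\<rho> * a\<close> if \<open>a\<close> is a non-zero
  valuation. Against a mutual match of own value \<open>a\<close>, an unpreferred mutual pair totals
  at most \<open>a + \<rho> * a\<close>, and a non-mutual pair at most \<open>\<rho> * a\<close>.
  The two prices of a mutual match exhaust the budget exactly; for other matches
  \<open>1 \<le> \<rho>\<close> suffices.\<close>

lemma general_ratio:
  assumes "complete_matching n \<nu>" and ne: "nonzero_valuations n U V \<noteq> {}"
  shows "inverse (1 + real_of_rat (sigma_max n U V) / real_of_rat (sigma_min n U V))
           * welfare n U V \<nu> \<le> welfare n U V \<mu>"
proof -
  let ?X = "nonzero_valuations n U V"
  have "?X \<subseteq> (\<lambda>(m, w). U m w) ` ({..<n} \<times> {..<n}) \<union> (\<lambda>(m, w). V m w) ` ({..<n} \<times> {..<n})"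
    by (auto simp: nonzero_valuations_def)
  then have fin: "finite ?X" by (rule finite_subset) auto
  define hi lo where "hi = real_of_rat (sigma_max n U V)" and "lo = real_of_rat (sigma_min n U V)"
  \<comment> \<open>The gap between 0 and \<open>lo\<close> is all that the estimate uses besides
    the upper bound \<open>hi\<close>.\<close>
  define S where "S = insert 0 {lo..hi}"
  have mem: "real_of_rat x \<in> {lo..hi}" if "x \<in> ?X" for x
    using that fin by (auto simp: hi_def lo_def sigma_max_def sigma_min_def of_rat_less_eq)
  have X: "sigma_min n U V \<in> ?X" using fin ne by (simp add: sigma_min_def)
  have "0 < x" if "x \<in> ?X" for x
    using that instance_ok by (auto simp: nonzero_valuations_def smc_instance_def less_le)
  with X have lo: "0 < lo" by (simp add: lo_def)
  have "lo \<le> hi" using mem[OF X] by simp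
  define \<rho> where "\<rho> = hi / lo"
  have \<rho>: "1 \<le> \<rho>" using lo \<open>lo \<le> hi\<close> by (simp add: \<rho>_def)
  define \<pi> :: "real \<Rightarrow> real \<Rightarrow> real" where
    "\<pi> a b = (if 0 < a \<and> 0 < b then (1 + \<rho>) * a else a + b)" for a b
  have Snn: "0 \<le> a" if "a \<in> S" for a using that lo by (auto simp: S_def)
  have big: "x \<le> \<rho> * a" if "a \<in> S" "0 < a" "x \<in> S" for a x
  proof -
    have "x \<le> hi" using that lo by (auto simp: S_def)
    also have "\<dots> = \<rho> * lo" using lo by (simp add: \<rho>_def)
    also have "\<dots> \<le> \<rho> * a" using that \<rho> by (intro mult_left_mono) (auto simp: S_def)
    finally show ?thesis .
  qed
  have "welfare n U V \<nu> \<le> (1 + \<rho>) * welfare n U V \<mu>"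
  proof (rule welfare_ratio[OF assms(1), where S = S and \<pi> = \<pi>])
    show "real_of_rat (U m w) \<in> S \<and> real_of_rat (V m w) \<in> S" if "m < n" "w < n" for m w
    proof -
      have "U m w = 0 \<or> U m w \<in> ?X" "V m w = 0 \<or> V m w \<in> ?X"
        using that by (auto simp: nonzero_valuations_def)
      then show ?thesis using mem by (auto simp: S_def)
    qed
    show "0 \<le> \<pi> a b" if "a \<in> S" "b \<in> S" for a b
      using Snn that \<rho> by (auto simp: \<pi>_def)
    show "x + y \<le> \<pi> a b" if "{a, b, x, y} \<subseteq> S" "\<not> worse a b x y" for a b x y
    proof -
      have "0 \<le> x" "0 \<le> y" using Snn that by auto
      show ?thesis
      proof (cases "0 < a \<and> 0 < b")
        case True
        then have *: "x \<le> \<rho> * a" "y \<le> \<rho> * a" using that big by auto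
        show ?thesis
        proof (cases "0 < x \<and> 0 < y")
          case True
          with \<open>0 < a \<and> 0 < b\<close> that have "x \<le> a" by (auto simp: worse_def)
          with * \<open>0 < a \<and> 0 < b\<close> show ?thesis by (simp add: \<pi>_def distrib_right)
        next
          \<comment> \<open>At most one of the two values is non-zero, so one share
            \<open>\<rho> * a\<close> pays for the pair.\<close>
          case False
          then have "x = 0 \<or> y = 0" using \<open>0 \<le> x\<close> \<open>0 \<le> y\<close> by auto
          with * \<open>0 < a \<and> 0 < b\<close> show ?thesis by (auto simp: \<pi>_def distrib_right)
        qed
      next
        case False
        with that show ?thesis by (auto simp: \<pi>_def worse_def)
      qed
    qed
    show "\<pi> a b + \<pi> b a \<le> (1 + \<rho>) * (a + b)" if "a \<in> S" "b \<in> S" for a b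
    proof -
      have "2 * (a + b) \<le> (1 + \<rho>) * (a + b)"
        using that \<rho> Snn by (intro mult_right_mono) auto
      then show ?thesis by (auto simp: \<pi>_def distrib_left)
    qed
  qed
  then show ?thesis
    using \<rho> by (simp add: field_simps flip: hi_def lo_def \<rho>_def)
qed

end

section \<open>Deferred acceptance\<close>

text \<open>Read \<open>mless m w w'\<close> as: \<open>m\<close> strictly prefers \<open>w'\<close>
  to \<open>w\<close>. Asymmetry and a transitive negation describe strict weak orders, so ties are
  allowed.\<close>

locale preferences =
  fixes n :: nat
    and mless wless :: "nat \<Rightarrow> nat \<Rightarrow> nat \<Rightarrow> bool"
  assumes mless_asym: "mless m w w' \<Longrightarrow> \<not> mless m w' w"
    and mless_trans: "\<not> mless m w w' \<Longrightarrow> \<not> mless m w' w'' \<Longrightarrow> \<not> mless m w w''"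
    and wless_asym: "wless w m m' \<Longrightarrow> \<not> wless w m' m"
    and wless_trans: "\<not> wless w m m' \<Longrightarrow> \<not> wless w m' m'' \<Longrightarrow> \<not> wless w m m''"
begin

text \<open>A single selection pass instead of a sort: a proposal only needs a most preferred
  candidate at the head.\<close>

fun best_first :: "nat \<Rightarrow> nat list \<Rightarrow> nat list" where
  "best_first m [] = []"
| "best_first m (x # xs) =
     (case best_first m xs of [] \<Rightarrow> [x]
      | b # r \<Rightarrow> if mless m b x then x # b # r else b # x # r)"

lemma length_best_first [simp]: "length (best_first m xs) = length xs"
  by (induction xs) (auto split: list.split)

lemma best_first_Nil_iff [simp]: "best_first m xs = [] \<longleftrightarrow> xs = []"
  by (metis length_best_first length_0_conv)

lemma set_best_first [simp]: "set (best_first m xs) = set xs"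
proof (induction xs)
  case (Cons x xs)
  then show ?case by (cases "best_first m xs") auto
qed simp

lemma hd_best_first: "y \<in> set xs \<Longrightarrow> \<not> mless m (hd (best_first m xs)) y"
proof (induction xs arbitrary: y)
  case (Cons x xs)
  show ?case
  proof (cases "best_first m xs")
    case Nil
    with Cons.prems show ?thesis using mless_asym by (auto dest: best_first_Nil_iff[THEN iffD1])
  next
    case (Cons b r)
    have "\<not> mless m b z" if "z \<in> set xs" for z
      using Cons.IH[OF that] Cons by simp
    moreover have "\<not> mless m x z" if "mless m b x" "\<not> mless m b z" for z
      using mless_asym[OF that(1)] mless_trans that(2) by blast
    moreover have "\<not> mless m x x" using mless_asym by blast
    ultimately show ?thesis
      using Cons.prems Cons by auto
  qed
qed simp

text \<open>
  A man is stored with the women who have not rejected him.  An engaged man's list begins with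
  his fiancee.
\<close>

definition reject :: "nat \<times> nat list \<Rightarrow> nat \<times> nat list" where
  "reject e = (fst e, tl (snd e))"

definition head :: "nat \<times> nat list \<Rightarrow> nat" where
  "head e = hd (snd e)"

text \<open>The second component is the man who loses, with the woman already removed from his list.
  On a tie she keeps her fiance.\<close>

fun propose ::
  "nat \<times> nat list \<Rightarrow> (nat \<times> nat list) list \<Rightarrow> (nat \<times> nat list) list \<times> (nat \<times> nat list) option"
where
  "propose e [] = ([e], None)"
| "propose e (f # es) =
     (if head e \<noteq> head f then (case propose e es of (es', l) \<Rightarrow> (f # es', l))
      else if wless (head e) (fst f) (fst e) then (e # es, Some (reject f))
      else (f # es, Some (reject e)))"

lemma propose_new: "head e \<notin> head ` set es \<Longrightarrow> propose e es = (es @ [e], None)"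
  by (induction es) auto

lemma propose_engaged:
  assumes "head f = head e" "head e \<notin> head ` set xs"
  shows "propose e (xs @ f # ys) =
    (if wless (head e) (fst f) (fst e) then (xs @ e # ys, Some (reject f))
     else (xs @ f # ys, Some (reject e)))"
  using assms(2) by (induction xs) (auto simp: assms(1))

text \<open>The invariant of deferred acceptance: a woman off the list cannot block with this man,
  because she holds one at least as good. The length bound serves the running time.\<close>

definition settled :: "(nat \<times> nat list) list \<Rightarrow> nat \<times> nat list \<Rightarrow> bool" where
  "settled es e \<longleftrightarrow> length (snd e) \<le> n \<and> set (snd e) \<subseteq> {..<n} \<and>
     (\<forall>w<n. w \<in> set (snd e) \<or> (\<exists>f\<in>set es. head f = w \<and> \<not> wless w (fst f) (fst e)))"

definition engaged :: "nat \<times> nat list \<Rightarrow> bool" where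
  "engaged e \<longleftrightarrow> snd e \<noteq> [] \<and> (\<forall>w\<in>set (snd e). \<not> mless (fst e) (head e) w)"

definition gs_inv :: "(nat \<times> nat list) list \<Rightarrow> (nat \<times> nat list) list \<Rightarrow> bool" where
  "gs_inv free es \<longleftrightarrow>
     distinct (map fst free @ map fst es) \<and> fst ` (set free \<union> set es) = {..<n} \<and>
     distinct (map head es) \<and> (\<forall>e\<in>set es. engaged e) \<and> (\<forall>e\<in>set free \<union> set es. settled es e)"

text \<open>A proposal either engages a free man or removes a woman from a list.\<close>

definition gs_steps :: "(nat \<times> nat list) list \<Rightarrow> (nat \<times> nat list) list \<Rightarrow> nat" where
  "gs_steps free es = sum_list (map (length \<circ> snd) (free @ es)) + length free"

text \<open>Women only trade up, so a refusal stays justified when engagements change.\<close>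

lemma settled_mono:
  assumes "settled es e"
    and "\<And>f. f \<in> set es \<Longrightarrow> \<exists>g\<in>set es'. head g = head f \<and> \<not> wless (head f) (fst g) (fst f)"
  shows "settled es' e"
  using assms unfolding settled_def by (metis wless_trans)

lemma gs_inv_length:
  assumes "gs_inv free es"
  shows "length free + length es = n"
proof -
  have "length (map fst free @ map fst es) = card (set (map fst free @ map fst es))"
    using assms unfolding gs_inv_def by (metis distinct_card)
  also have "set (map fst free @ map fst es) = {..<n}"
    using assms by (simp add: gs_inv_def image_Un)
  finally show ?thesis by simp
qed

text \<open>If a free man had an empty list, all \<open>n\<close> women would be engaged, although
  fewer than \<open>n\<close> men are.\<close>

lemma gs_inv_candidates:
  assumes "gs_inv (e # free) es"
  shows "snd e \<noteq> []"
proof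
  assume "snd e = []"
  with assms have "{..<n} \<subseteq> head ` set es"
    by (force simp: gs_inv_def settled_def)
  then have "n \<le> card (head ` set es)"
    using card_mono[of "head ` set es" "{..<n}"] by simp
  also have "\<dots> \<le> length es" using card_image_le card_length order_trans by blast
  finally show False using gs_inv_length[OF assms] by simp
qed

text \<open>The proposed woman is free, changes to the proposer, or keeps her fiance. She never ends
  up with a worse man, so \<open>settled_mono\<close> preserves the invariant for everyone, and the
  loser may drop her from his list.\<close>

lemma gs_inv_step:
  assumes inv: "gs_inv ((m, cs) # free) es"
    and pr: "propose (m, best_first m cs) es = (es', l)"
    and free': "free' = (case l of None \<Rightarrow> free | Some e \<Rightarrow> e # free)"
  shows "gs_inv free' es'" "gs_steps free' es' < gs_steps ((m, cs) # free) es"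
proof -
  define e where "e = (m, best_first m cs)"
  have ne: "cs \<noteq> []" using gs_inv_candidates[OF inv] by simp
  have eng: "engaged e"
    using ne hd_best_first by (auto simp: engaged_def e_def head_def)
  have sete: "settled fs e \<longleftrightarrow> settled fs (m, cs)" for fs
    by (simp add: settled_def e_def)
  have fste: "fst e = m" and lene: "length (snd e) = length cs" by (simp_all add: e_def)
  \<comment> \<open>The dropped woman is the head of the list, and \<open>g\<close> is the man she
    holds instead.\<close>
  have rej: "settled fs (reject d)"
    if d: "settled fs d" "snd d \<noteq> []" "g \<in> set fs" "head g = head d" "\<not> wless (head d) (fst g) (fst d)"
    for fs d g
  proof -
    obtain x c r where "d = (x, c # r)" using d(2) by (cases d; cases "snd d") auto
    show ?thesis using that unfolding \<open>d = _\<close> by (auto simp: settled_def reject_def head_def)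
  qed
  have goal: "gs_inv free' es' \<and> gs_steps free' es' < gs_steps ((m, cs) # free) es"
  proof (cases "head e \<in> head ` set es")
    case False
    then have [simp]: "es' = es @ [e]" "l = None"
      using pr propose_new[of e es] by (auto simp: e_def)
    have mono: "settled es' d" if "settled es d" for d
      by (rule settled_mono[OF that]) (use wless_asym in auto)
    have "settled es' e" using inv mono sete by (simp add: gs_inv_def)
    then show ?thesis using inv eng False mono fste lene
      by (auto simp: gs_inv_def free' gs_steps_def)
  next
    case True
    then have "\<exists>f\<in>set es. head f = head e" by (metis image_iff)
    from split_list_first_prop[OF this] obtain xs f ys where es: "es = xs @ f # ys"
      and f: "head f = head e" and "\<forall>g\<in>set xs. head g \<noteq> head e"
      by blast
    then have nin: "head e \<notin> head ` set xs" by force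
    have engf: "engaged f" using inv es by (auto simp: gs_inv_def)
    show ?thesis
    proof (cases "wless (head e) (fst f) m")
      case win: True
      then have [simp]: "es' = xs @ e # ys" "l = Some (reject f)"
        using pr propose_engaged[OF f nin, of ys] by (auto simp: e_def es)
      have mono: "settled es' d" if "settled es d" for d
      proof (rule settled_mono[OF that])
        \<comment> \<open>Only the woman \<open>head e\<close> changes partner, from
          \<open>f\<close> to the proposer she prefers.\<close>
        fix g assume "g \<in> set es"
        then consider "g = f" | "g \<in> set es'" by (auto simp: es)
        then show "\<exists>h\<in>set es'. head h = head g \<and> \<not> wless (head g) (fst h) (fst g)"
        proof cases
          case 1
          with win f wless_asym show ?thesis by (intro bexI[of _ e]) (auto simp: fste)
        next
          case 2
          with wless_asym show ?thesis by blast
        qed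
      qed
      have "settled es' f" using inv es mono by (auto simp: gs_inv_def)
      then have "settled es' (reject f)"
        by (rule rej[of _ _ e]) (use engf f win wless_asym in \<open>auto simp: engaged_def fste\<close>)
      moreover have "length (snd (reject f)) < length (snd f)" "fst (reject f) = fst f"
        using engf by (simp_all add: engaged_def reject_def)
      moreover have "\<forall>d\<in>set free \<union> set es'. settled es' d"
        using inv mono sete by (auto simp: gs_inv_def es)
      moreover have "\<forall>d\<in>set es'. engaged d" using inv eng by (auto simp: gs_inv_def es)
      moreover have "distinct (map head es')" using inv f by (auto simp: gs_inv_def es)
      moreover have "distinct (map fst (reject f # free) @ map fst es')"
        using inv fste calculation(3) by (auto simp: gs_inv_def es)
      moreover have "fst ` (set (reject f # free) \<union> set es') = fst ` (set ((m, cs) # free) \<union> set es)"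
        using fste calculation(3) by (simp add: es image_Un insert_commute)
      moreover have "fst ` (set ((m, cs) # free) \<union> set es) = {..<n}"
        using inv by (simp only: gs_inv_def)
      ultimately show ?thesis
        unfolding gs_inv_def free' by (simp add: gs_steps_def es lene)
    next
      case lose: False
      then have [simp]: "es' = es" "l = Some (reject e)"
        using pr propose_engaged[OF f nin, of ys] by (auto simp: e_def es)
      have "settled es e" using inv sete by (simp add: gs_inv_def)
      then have "settled es (reject e)"
        by (rule rej[of _ _ f]) (use eng f lose in \<open>simp_all add: engaged_def es fste\<close>)
      moreover have "length (snd (reject e)) < length cs" "fst (reject e) = m"
        using ne by (simp_all add: reject_def e_def)
      ultimately show ?thesis
        using inv by (simp add: gs_inv_def free' gs_steps_def)
    qed
  qed
  then show "gs_inv free' es'" "gs_steps free' es' < gs_steps ((m, cs) # free) es" by auto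
qed

text \<open>With nobody free, \<open>n\<close> men have \<open>n\<close> distinct fiancees, hence
  all women are matched and the two lookups are inverse. The last clause connects
  \<open>\<sigma>\<close> with the list that the program scans for its output.\<close>

lemma gs_inv_final:
  assumes "gs_inv [] es"
  obtains \<sigma> \<tau> where "\<And>m. m < n \<Longrightarrow> \<sigma> m < n" "\<And>w. w < n \<Longrightarrow> \<tau> w < n"
    "\<And>m. m < n \<Longrightarrow> \<tau> (\<sigma> m) = m" "\<And>w. w < n \<Longrightarrow> \<sigma> (\<tau> w) = w"
    "\<And>m w. m < n \<Longrightarrow> w < n \<Longrightarrow> \<not> mless m (\<sigma> m) w \<or> \<not> wless w (\<tau> w) m"
    "\<And>m w. m < n \<Longrightarrow> (\<exists>e\<in>set es. fst e = m \<and> head e = w) \<longleftrightarrow> \<sigma> m = w"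
proof -
  have men: "fst ` set es = {..<n}" and dm: "inj_on fst (set es)" and dw: "inj_on head (set es)"
    and set: "\<And>e. e \<in> set es \<Longrightarrow> settled es e" and eng: "\<And>e. e \<in> set es \<Longrightarrow> engaged e"
    using assms by (auto simp: gs_inv_def distinct_map)
  have "head e < n" if "e \<in> set es" for e
    using set[OF that] eng[OF that] hd_in_set[of "snd e"]
    by (auto simp: settled_def engaged_def head_def simp del: hd_in_set)
  then have hn: "head ` set es \<subseteq> {..<n}" by auto
  moreover have "card (head ` set es) = n"
    using card_image[OF dw] card_image[OF dm] men by simp
  ultimately have women: "head ` set es = {..<n}"
    by (intro card_subset_eq) auto
  define em where "em = the_inv_into (set es) fst"
  define ew where "ew = the_inv_into (set es) head"
  have em: "em m \<in> set es" "fst (em m) = m" if "m < n" for m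
    using that men the_inv_into_into[OF dm, of m] f_the_inv_into_f[OF dm, of m]
    by (auto simp: em_def)
  have ew: "ew w \<in> set es" "head (ew w) = w" if "w < n" for w
    using that women the_inv_into_into[OF dw, of w] f_the_inv_into_f[OF dw, of w]
    by (auto simp: ew_def)
  have emI: "em (fst e) = e" and ewI: "ew (head e) = e" if "e \<in> set es" for e
    using that dm dw by (auto simp: em_def ew_def the_inv_into_f_f)
  show thesis
  proof (rule that[of "\<lambda>m. head (em m)" "\<lambda>w. fst (ew w)"])
    show "head (em m) < n" if "m < n" for m using em(1)[OF that] hn by auto
    show "fst (ew w) < n" if "w < n" for w using ew(1)[OF that] men by auto
    show "fst (ew (head (em m))) = m" if "m < n" for m using em[OF that] by (simp add: ewI)
    show "head (em (fst (ew w))) = w" if "w < n" for w using ew[OF that] by (simp add: emI)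
    show "\<not> mless m (head (em m)) w \<or> \<not> wless w (fst (ew w)) m" if mw: "m < n" "w < n" for m w
    \<comment> \<open>If \<open>w\<close> is still on the list, \<open>m\<close> does not prefer her
      to its head; otherwise \<open>settled\<close> says that she does not prefer him.\<close>
    proof (cases "w \<in> set (snd (em m))")
      case True
      then show ?thesis using eng[OF em(1)[OF mw(1)]] em(2)[OF mw(1)]
        by (auto simp: engaged_def)
    next
      case False
      then obtain f where "f \<in> set es" "head f = w" "\<not> wless w (fst f) m"
        using set[OF em(1)[OF mw(1)]] em(2)[OF mw(1)] mw(2) by (auto simp: settled_def)
      then show ?thesis using ewI[OF \<open>f \<in> set es\<close>] by auto
    qed
    show "(\<exists>e\<in>set es. fst e = m \<and> head e = w) \<longleftrightarrow> head (em m) = w" if "m < n" for m w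
      using em[OF that] emI by auto
  qed
qed

lemma gs_inv_init: "gs_inv (map (\<lambda>m. (m, [0..<n])) [0..<n]) []"
  by (auto simp: gs_inv_def settled_def comp_def image_def)

end

section \<open>Weakest preconditions for programs\<close>

text \<open>
  The rules for \<open>wp\<close> are equivalences, so that the simplifier executes a program symbolically.
\<close>

definition wp :: "program \<Rightarrow> val list \<Rightarrow> exp \<Rightarrow> (val \<Rightarrow> nat \<Rightarrow> bool) \<Rightarrow> bool" where
  "wp P \<rho> e Q \<longleftrightarrow> (\<exists>v t. eval P \<rho> e v t \<and> Q v t)"

definition wps :: "program \<Rightarrow> val list \<Rightarrow> exp list \<Rightarrow> (val list \<Rightarrow> nat \<Rightarrow> bool) \<Rightarrow> bool" where
  "wps P \<rho> es Q \<longleftrightarrow> (\<exists>vs t. evals P \<rho> es vs t \<and> Q vs t)"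

text \<open>Kept as a separate constant so that symbolic execution stops at each call, where the
  specification of the callee is applied.\<close>

definition wpf :: "program \<Rightarrow> nat \<Rightarrow> val list \<Rightarrow> (val \<Rightarrow> nat \<Rightarrow> bool) \<Rightarrow> bool" where
  "wpf P f vs Q \<longleftrightarrow> f < length P \<and> wp P vs (P ! f) Q"

lemma wp_Var: "wp P \<rho> (Var i) Q \<longleftrightarrow> i < length \<rho> \<and> Q (\<rho> ! i) (Suc 0)"
  unfolding wp_def by (auto elim!: eval_VarE intro: eval_Var[simplified])

lemma wp_Const: "wp P \<rho> (Const i) Q \<longleftrightarrow> Q (IntV i) (Suc 0)"
  unfolding wp_def by (auto elim!: eval_ConstE intro: eval_Const[simplified])

text \<open>False on a value of the wrong shape, where evaluation is stuck. Unlike an existential,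
  it rewrites away once the constructor is known.\<close>

definition int_case :: "val \<Rightarrow> (int \<Rightarrow> bool) \<Rightarrow> bool" where
  "int_case v Q = (case v of IntV i \<Rightarrow> Q i | PairV _ _ \<Rightarrow> False)"

definition pair_case :: "val \<Rightarrow> (val \<Rightarrow> val \<Rightarrow> bool) \<Rightarrow> bool" where
  "pair_case v Q = (case v of IntV i \<Rightarrow> False | PairV x y \<Rightarrow> Q x y)"

lemma int_case_simps [simp]: "int_case (IntV i) Q = Q i" "int_case (PairV x y) Q = False"
  by (simp_all add: int_case_def)

lemma pair_case_simps [simp]: "pair_case (IntV i) Q' = False" "pair_case (PairV x y) Q' = Q' x y"
  by (simp_all add: pair_case_def)

lemma int_case_iff: "int_case v Q \<longleftrightarrow> (\<exists>i. v = IntV i \<and> Q i)"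
  by (cases v) auto

lemma pair_case_iff: "pair_case v Q \<longleftrightarrow> (\<exists>x y. v = PairV x y \<and> Q x y)"
  by (cases v) auto

lemma wp_Arith: "wp P \<rho> (Arith f a b) Q \<longleftrightarrow>
    wp P \<rho> a (\<lambda>v s. int_case v (\<lambda>i. wp P \<rho> b (\<lambda>w t. int_case w (\<lambda>j.
      Q (IntV (arith_op f i j)) (s + t + int_size i * int_size j)))))"
  unfolding wp_def int_case_iff by (fast elim!: eval_ArithE intro: eval_Arith[simplified])

lemma wp_IfLess: "wp P \<rho> (IfLess a b c d) Q \<longleftrightarrow>
    wp P \<rho> a (\<lambda>v r. int_case v (\<lambda>i. wp P \<rho> b (\<lambda>w s. int_case w (\<lambda>j.
      if i < j then wp P \<rho> c (\<lambda>v t. Q v (r + s + t + int_size i * int_size j))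
      else wp P \<rho> d (\<lambda>v t. Q v (r + s + t + int_size i * int_size j))))))"
proof
  show "wp P \<rho> (IfLess a b c d) Q \<Longrightarrow>
    wp P \<rho> a (\<lambda>v r. int_case v (\<lambda>i. wp P \<rho> b (\<lambda>w s. int_case w (\<lambda>j.
      if i < j then wp P \<rho> c (\<lambda>v t. Q v (r + s + t + int_size i * int_size j))
      else wp P \<rho> d (\<lambda>v t. Q v (r + s + t + int_size i * int_size j))))))"
    unfolding wp_def int_case_iff by (elim exE conjE eval_IfLessE) (metis not_less)+
  show "wp P \<rho> (IfLess a b c d) Q" if "wp P \<rho> a (\<lambda>v r. int_case v (\<lambda>i. wp P \<rho> b (\<lambda>w s. int_case w (\<lambda>j.
      if i < j then wp P \<rho> c (\<lambda>v t. Q v (r + s + t + int_size i * int_size j))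
      else wp P \<rho> d (\<lambda>v t. Q v (r + s + t + int_size i * int_size j))))))"
  proof -
    from that obtain i r j s where a: "eval P \<rho> a (IntV i) r" and b: "eval P \<rho> b (IntV j) s"
      and *: "if i < j then wp P \<rho> c (\<lambda>v t. Q v (r + s + t + int_size i * int_size j))
        else wp P \<rho> d (\<lambda>v t. Q v (r + s + t + int_size i * int_size j))"
      unfolding wp_def[of P \<rho> a] wp_def[of P \<rho> b] int_case_iff by blast
    show ?thesis
    proof (cases "i < j")
      case True
      with * obtain v t where "eval P \<rho> c v t" "Q v (r + s + t + int_size i * int_size j)"
        by (auto simp: wp_def)
      then show ?thesis unfolding wp_def using eval_IfLess_True[OF True a b] by blast
    next
      case False
      with * obtain v t where "eval P \<rho> d v t" "Q v (r + s + t + int_size i * int_size j)"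
        by (auto simp: wp_def)
      then show ?thesis unfolding wp_def using eval_IfLess_False[OF False a b] by blast
    qed
  qed
qed

lemma wp_MkPair: "wp P \<rho> (MkPair a b) Q \<longleftrightarrow>
    wp P \<rho> a (\<lambda>v s. wp P \<rho> b (\<lambda>w t. Q (PairV v w) (Suc (s + t))))"
  unfolding wp_def by (fast elim!: eval_MkPairE intro: eval_MkPair[simplified])

lemma wp_Fst: "wp P \<rho> (Fst a) Q \<longleftrightarrow> wp P \<rho> a (\<lambda>v t. pair_case v (\<lambda>x y. Q x (Suc t)))"
  unfolding wp_def pair_case_iff by (fast elim!: eval_FstE intro: eval_Fst[simplified])

lemma wp_Snd: "wp P \<rho> (Snd a) Q \<longleftrightarrow> wp P \<rho> a (\<lambda>v t. pair_case v (\<lambda>x y. Q y (Suc t)))"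
  unfolding wp_def pair_case_iff by (fast elim!: eval_SndE intro: eval_Snd[simplified])

lemma wp_IfPair: "wp P \<rho> (IfPair a b c) Q \<longleftrightarrow>
    wp P \<rho> a (\<lambda>v s. case v of PairV _ _ \<Rightarrow> wp P \<rho> b (\<lambda>v t. Q v (Suc (s + t)))
                     | IntV _ \<Rightarrow> wp P \<rho> c (\<lambda>v t. Q v (Suc (s + t))))"
proof
  show "wp P \<rho> (IfPair a b c) Q \<Longrightarrow>
    wp P \<rho> a (\<lambda>v s. case v of PairV _ _ \<Rightarrow> wp P \<rho> b (\<lambda>v t. Q v (Suc (s + t)))
                     | IntV _ \<Rightarrow> wp P \<rho> c (\<lambda>v t. Q v (Suc (s + t))))"
    unfolding wp_def by (elim exE conjE eval_IfPairE) (fastforce)+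
  show "wp P \<rho> (IfPair a b c) Q"
    if "wp P \<rho> a (\<lambda>v s. case v of PairV _ _ \<Rightarrow> wp P \<rho> b (\<lambda>v t. Q v (Suc (s + t)))
                     | IntV _ \<Rightarrow> wp P \<rho> c (\<lambda>v t. Q v (Suc (s + t))))"
  proof -
    from that obtain v s where a: "eval P \<rho> a v s"
      and *: "case v of PairV _ _ \<Rightarrow> wp P \<rho> b (\<lambda>v t. Q v (Suc (s + t)))
                     | IntV _ \<Rightarrow> wp P \<rho> c (\<lambda>v t. Q v (Suc (s + t)))"
      unfolding wp_def[of P \<rho> a] by blast
    show ?thesis
    proof (cases v)
      case (IntV i)
      with * a show ?thesis unfolding wp_def using eval_IfPair_False[of P \<rho> a i s] by fastforce
    next
      case (PairV x y)
      with * a show ?thesis unfolding wp_def using eval_IfPair_True[of P \<rho> a x y s] by fastforce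
    qed
  qed
qed

lemma wp_LetIn: "wp P \<rho> (LetIn a b) Q \<longleftrightarrow>
    wp P \<rho> a (\<lambda>v s. wp P (v # \<rho>) b (\<lambda>w t. Q w (Suc (s + t))))"
  unfolding wp_def by (fast elim!: eval_LetInE intro: eval_LetIn[simplified])

lemma wp_Call: "wp P \<rho> (Call f es) Q \<longleftrightarrow>
    wps P \<rho> es (\<lambda>vs s. wpf P f vs (\<lambda>v t. Q v (Suc (s + t))))"
  unfolding wp_def wps_def wpf_def by (fast elim!: eval_CallE intro: eval_Call[simplified])

lemma wps_Nil: "wps P \<rho> [] Q \<longleftrightarrow> Q [] 0"
  unfolding wps_def by (fast elim!: evals_NilE intro: evals_Nil[simplified])

lemma wps_Cons: "wps P \<rho> (e # es) Q \<longleftrightarrow>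
    wp P \<rho> e (\<lambda>v s. wps P \<rho> es (\<lambda>vs t. Q (v # vs) (s + t)))"
  unfolding wp_def wps_def by (fast elim!: evals_ConsE intro: evals_Cons[simplified])

lemmas wp_simps = wp_Var wp_Const wp_Arith wp_IfLess wp_MkPair wp_Fst wp_Snd wp_IfPair wp_LetIn
  wp_Call wps_Nil wps_Cons

definition returns :: "program \<Rightarrow> nat \<Rightarrow> val list \<Rightarrow> val \<Rightarrow> nat \<Rightarrow> bool" where
  "returns P f vs r T \<longleftrightarrow> wpf P f vs (\<lambda>v t. v = r \<and> t \<le> T)"

text \<open>Replaces a call by its specified result, keeping only the bound on its time.\<close>

lemma wpf_returns:
  assumes "returns P f vs r T" "\<And>t. t \<le> T \<Longrightarrow> Q r t"
  shows "wpf P f vs Q"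
  using assms unfolding returns_def wpf_def wp_def by blast

lemma returns_mono: "returns P f vs r T \<Longrightarrow> T \<le> T' \<Longrightarrow> returns P f vs r T'"
  unfolding returns_def wpf_def wp_def by (meson order_trans)

section \<open>The program\<close>

text \<open>The language has no equality test; \<open>0 < sq a b\<close> expresses that
  \<open>a\<close> and \<open>b\<close> differ.\<close>

definition "sq a b = Arith Mul (Arith Sub a b) (Arith Sub a b)"

text \<open>
  On non-negative arguments a positive product of numerators means that both are positive.
\<close>

definition less_body :: exp where
  "less_body =
    (let num1 = Fst (Fst (Var 0)); den1 = Snd (Fst (Var 0)); num2 = Fst (Snd (Var 0)); den2 = Snd (Snd (Var 0));
         num1' = Fst (Fst (Var 1)); den1' = Snd (Fst (Var 1)); num2' = Fst (Snd (Var 1)); den2' = Snd (Snd (Var 1))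
     in IfLess (Const 0) (Arith Mul num1 num2)
          (IfLess (Const 0) (Arith Mul num1' num2')
            (IfLess (Arith Mul num1 den1') (Arith Mul num1' den1) (Const 1)
              (IfLess (Arith Mul num1' den1) (Arith Mul num1 den1') (Const 0)
                (IfLess (Arith Mul num2 den2') (Arith Mul num2' den2) (Const 1) (Const 0))))
            (Const 0))
          (IfLess (Const 0) (Arith Mul num1' num2')
            (Const 1)
            (IfLess
              (Arith Mul (Arith Add (Arith Mul num1 den2) (Arith Mul num2 den1)) (Arith Mul den1' den2'))
              (Arith Mul (Arith Add (Arith Mul num1' den2') (Arith Mul num2' den1')) (Arith Mul den1 den2))
              (Const 1) (Const 0))))"

text \<open>
  In the inner branches, \<open>Var 0\<close> is the tail with its best candidate moved to the front.
\<close>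

definition best_body :: exp where
  "best_body =
     IfPair (Var 0)
       (LetIn (Call 2 [Snd (Var 0)])
         (IfPair (Var 0)
           (IfLess (Const 0) (Call 1 [Snd (Fst (Var 0)), Snd (Fst (Var 1))])
             (MkPair (Fst (Var 1)) (Var 0))
             (MkPair (Fst (Var 0)) (MkPair (Fst (Var 1)) (Snd (Var 0)))))
           (Var 1)))
       (Var 0)"

text \<open>A man is his number with a list of candidates, each a woman with the values
  \<open>U\<close> and \<open>V\<close>. Two rivals can therefore be compared from the heads of
  their lists, where \<open>swapped\<close> puts the woman's value first. The integer 0 encodes both
  the empty list and the absence of a loser.\<close>

definition propose_body :: exp where
  "propose_body =
    (let woman = (\<lambda>e. Fst (Fst (Snd e)));
         swapped = (\<lambda>e. MkPair (Snd (Snd (Fst (Snd e)))) (Fst (Snd (Fst (Snd e)))));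
         rejected = (\<lambda>e. MkPair (Fst e) (Snd (Snd e)))
     in IfPair (Var 1)
          (IfLess (Const 0) (sq (woman (Var 0)) (woman (Fst (Var 1))))
            (LetIn (Call 3 [Var 0, Snd (Var 1)])
              (MkPair (MkPair (Fst (Var 2)) (Fst (Var 0))) (Snd (Var 0))))
            (IfLess (Const 0) (Call 1 [swapped (Fst (Var 1)), swapped (Var 0)])
              (MkPair (MkPair (Var 0) (Snd (Var 1))) (rejected (Fst (Var 1))))
              (MkPair (Var 1) (rejected (Var 0)))))
          (MkPair (MkPair (Var 0) (Const 0)) (Const 0)))"

definition gs_body :: exp where
  "gs_body =
     IfPair (Var 0)
       (LetIn (Call 3 [MkPair (Fst (Fst (Var 0))) (Call 2 [Snd (Fst (Var 0))]), Var 1])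
         (IfPair (Snd (Var 0))
           (Call 4 [MkPair (Snd (Var 0)) (Snd (Var 1)), Fst (Var 0)])
           (Call 4 [Snd (Var 1), Fst (Var 0)])))
       (Var 1)"

text \<open>The arguments are the remaining entries of one row of \<open>U\<close> and of
  \<open>V\<close>, and the number of the next woman.\<close>

definition candidates_body :: exp where
  "candidates_body =
     IfPair (Var 0)
       (MkPair (MkPair (Var 2) (MkPair (Fst (Var 0)) (Fst (Var 1))))
         (Call 5 [Snd (Var 0), Snd (Var 1), Arith Add (Var 2) (Const 1)]))
       (Const 0)"

definition men_body :: exp where
  "men_body =
     IfPair (Var 0)
       (MkPair (MkPair (Var 2) (Call 5 [Fst (Var 0), Fst (Var 1), Const 0]))
         (Call 6 [Snd (Var 0), Snd (Var 1), Arith Add (Var 2) (Const 1)]))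
       (Const 0)"

text \<open>Searches the engaged men for number \<open>Var 0\<close> with fiancee
  \<open>Var 1\<close>; the sum of squares vanishes exactly if both agree. The results are the
  fractions 1/1 and 0/1.\<close>

definition cell_body :: exp where
  "cell_body =
     IfPair (Var 2)
       (IfLess (Const 0) (Arith Add (sq (Var 0) (Fst (Fst (Var 2)))) (sq (Var 1) (Fst (Fst (Snd (Fst (Var 2)))))))
         (Call 7 [Var 0, Var 1, Snd (Var 2)])
         (MkPair (Const 1) (Const 1)))
       (MkPair (Const 0) (Const 1))"

definition row_body :: exp where
  "row_body =
     IfLess (Var 1) (Var 2)
       (MkPair (Call 7 [Var 0, Var 1, Var 3]) (Call 8 [Var 0, Arith Add (Var 1) (Const 1), Var 2, Var 3]))
       (Const 0)"

definition matrix_body :: exp where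
  "matrix_body =
     IfLess (Var 0) (Var 1)
       (MkPair (Call 8 [Var 0, Const 0, Var 1, Var 2]) (Call 9 [Arith Add (Var 0) (Const 1), Var 1, Var 2]))
       (Const 0)"

definition main_body :: exp where
  "main_body =
     Call 9 [Const 0, Fst (Var 0),
       Call 4 [Call 6 [Fst (Snd (Var 0)), Snd (Snd (Var 0)), Const 0], Const 0]]"

definition prog :: program where
  "prog = [main_body, less_body, best_body, propose_body, gs_body, candidates_body, men_body,
     cell_body, row_body, matrix_body]"

lemma prog_simps:
  "wpf prog 0 vs Q = wp prog vs main_body Q"
  "wpf prog 1 vs Q = wp prog vs less_body Q"
  "wpf prog 2 vs Q = wp prog vs best_body Q"
  "wpf prog 3 vs Q = wp prog vs propose_body Q"
  "wpf prog 4 vs Q = wp prog vs gs_body Q"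
  "wpf prog 5 vs Q = wp prog vs candidates_body Q"
  "wpf prog 6 vs Q = wp prog vs men_body Q"
  "wpf prog 7 vs Q = wp prog vs cell_body Q"
  "wpf prog 8 vs Q = wp prog vs row_body Q"
  "wpf prog 9 vs Q = wp prog vs matrix_body Q"
  by (simp_all add: wpf_def prog_def)

section \<open>Running time\<close>

lemma nat_abs_mult: "nat \<bar>i * j\<bar> = nat \<bar>i\<bar> * nat \<bar>j\<bar>"
  by (simp add: abs_mult nat_mult_distrib)

lemma int_size_bound: "nat \<bar>i\<bar> < 2 ^ (int_size i - 1)"
proof (cases "i = 0")
  case False
  then show ?thesis
    using floorlog_bounds[of "nat \<bar>i\<bar>" 2] by (simp add: int_size_def)
qed (simp add: int_size_def)

lemma int_size_le: "nat \<bar>i\<bar> < 2 ^ k \<Longrightarrow> int_size i \<le> Suc k"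
  unfolding int_size_def using floorlog_le_iff[of 2 "nat \<bar>i\<bar>" k] by simp

lemma int_size_pos: "1 \<le> int_size i"
  by (simp add: int_size_def)

lemma int_size_mult: "int_size (i * j) \<le> int_size i + int_size j"
proof -
  have "nat \<bar>i * j\<bar> < 2 ^ ((int_size i - 1) + (int_size j - 1))"
    unfolding nat_abs_mult power_add by (intro mult_strict_mono int_size_bound) auto
  from int_size_le[OF this] show ?thesis using int_size_pos[of i] int_size_pos[of j] by simp
qed

text \<open>The carry bit fits because each \<open>int_size\<close> counts one unit more than the
  binary digits.\<close>

lemma int_size_add: "int_size (i + j) \<le> int_size i + int_size j"
proof -
  let ?a = "int_size i - 1" and ?b = "int_size j - 1"
  have "nat \<bar>i + j\<bar> \<le> nat \<bar>i\<bar> + nat \<bar>j\<bar>" by linarith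
  also have "\<dots> < 2 ^ ?a + 2 ^ ?b" by (intro add_strict_mono int_size_bound)
  also have "\<dots> \<le> 2 ^ (?a + ?b) + 2 ^ (?a + ?b)" by (intro add_mono power_increasing) auto
  also have "\<dots> = 2 ^ Suc (?a + ?b)" by simp
  finally show ?thesis
    using int_size_le[of "i + j" "Suc (?a + ?b)"] int_size_pos[of i] int_size_pos[of j] by simp
qed

lemma int_size_minus [simp]: "int_size (- i) = int_size i"
  by (simp add: int_size_def)

lemma int_size_diff: "int_size (i - j) \<le> int_size i + int_size j"
  using int_size_add[of i "- j"] by simp

lemma int_size_mono: "i \<le> j \<Longrightarrow> int_size (int i) \<le> int_size (int j)"
  by (simp add: int_size_def floorlog_mono)

lemma int_size_0 [simp]: "int_size 0 = 1" and int_size_1 [simp]: "int_size 1 = 2"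
  by (simp_all add: int_size_def floorlog_def)

text \<open>Applied backwards with a schematic right-hand side, these rules synthesise a bound.\<close>

lemma int_size_mult_le: "int_size i \<le> a \<Longrightarrow> int_size j \<le> b \<Longrightarrow> int_size (i * j) \<le> a + b"
  by (meson add_mono int_size_mult order_trans)
lemma int_size_add_le: "int_size i \<le> a \<Longrightarrow> int_size j \<le> b \<Longrightarrow> int_size (i + j) \<le> a + b"
  by (meson add_mono int_size_add order_trans)
lemma int_size_diff_le: "int_size i \<le> a \<Longrightarrow> int_size j \<le> b \<Longrightarrow> int_size (i - j) \<le> a + b"
  by (meson add_mono int_size_diff order_trans)

lemmas cost_intros = add_le_mono mult_le_mono int_size_mult_le int_size_add_le int_size_diff_le

section \<open>Comparing rationals by integer arithmetic\<close>

definition num :: "rat \<Rightarrow> int" where "num r = fst (quotient_of r)"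
definition den :: "rat \<Rightarrow> int" where "den r = snd (quotient_of r)"

lemma encode_rat_eq: "encode_rat r = PairV (IntV (num r)) (IntV (den r))"
  by (simp add: encode_rat_def num_def den_def)

lemma den_pos: "0 < den r"
  by (simp add: den_def quotient_of_denom_pos')

lemma rat_eq: "r = of_int (num r) / of_int (den r)"
  by (metis num_def den_def prod.collapse quotient_of_div)

lemma rat_less_iff: "a < b \<longleftrightarrow> num a * den b < num b * den a"
  by (simp add: rat_less_code num_def den_def mult.commute split: prod.split)

lemma rat_add_less_iff:
  "a + b < a' + b' \<longleftrightarrow>
    (num a * den b + num b * den a) * (den a' * den b') < (num a' * den b' + num b' * den a') * (den a * den b)"
proof -
  have *: "a + b = of_int (num a * den b + num b * den a) / of_int (den a * den b)" for a b :: rat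
    using den_pos[of a] den_pos[of b] by (subst rat_eq[of a], subst rat_eq[of b]) (simp add: field_simps)
  have d: "(0::rat) < of_int (den a * den b)" for a b
    using den_pos[of a] den_pos[of b] by simp
  have "a + b < a' + b' \<longleftrightarrow>
    (of_int ((num a * den b + num b * den a) * (den a' * den b')) :: rat) <
     of_int ((num a' * den b' + num b' * den a') * (den a * den b))"
    unfolding *[of a b] *[of a' b'] of_int_mult[of "_ + _"]
    using d[of a b] d[of a' b'] by (simp only: divide_less_eq less_divide_eq if_True times_divide_eq_left)
  then show ?thesis by (simp only: of_int_less_iff)
qed

lemma num_pos_iff: "0 < num a \<longleftrightarrow> 0 < a" and num_nonneg: "0 \<le> a \<Longrightarrow> 0 \<le> num a"
  using den_pos[of a] rat_eq[of a] by (metis of_int_0_less_iff zero_less_divide_iff order_less_asym)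
    (metis den_pos of_int_0_le_iff of_int_0_less_iff rat_eq zero_le_divide_iff less_le_not_le)

lemma both_pos_iff: "0 \<le> a \<Longrightarrow> 0 \<le> b \<Longrightarrow> 0 < num a * num b \<longleftrightarrow> 0 < a \<and> 0 < b"
  using num_nonneg[of a] num_nonneg[of b] by (auto simp: zero_less_mult_iff simp flip: num_pos_iff)

definition short :: "nat \<Rightarrow> rat \<Rightarrow> bool" where
  "short L r \<longleftrightarrow> int_size (num r) \<le> L \<and> int_size (den r) \<le> L"

text \<open>Each path performs boundedly many operations on integers of size linear in
  \<open>L\<close>. The factor 500 also absorbs the unit costs.\<close>

lemma less_returns:
  assumes "0 \<le> a" "0 \<le> b" "0 \<le> a'" "0 \<le> b'" and L: "2 \<le> L"
    and sh: "short L a" "short L b" "short L a'" "short L b'"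
  shows "returns prog 1 [PairV (encode_rat a) (encode_rat b), PairV (encode_rat a') (encode_rat b')]
    (IntV (if worse a b a' b' then 1 else 0)) (500 * (L * L))"
proof -
  have LL: "L \<le> L * L" "1 \<le> L * L" using L by auto
  note sh' = sh[unfolded short_def, THEN conjunct1] sh[unfolded short_def, THEN conjunct2]
  \<comment> \<open>The tests become propositional atoms, so that symbolic execution follows a truth
    assignment.\<close>
  define A A' where "A \<longleftrightarrow> 0 < a \<and> 0 < b" and "A' \<longleftrightarrow> 0 < a' \<and> 0 < b'"
  define C C' D E where "C \<longleftrightarrow> a < a'" and "C' \<longleftrightarrow> a' < a" and "D \<longleftrightarrow> b < b'" and "E \<longleftrightarrow> a + b < a' + b'"
  have tests: "0 < num a * num b \<longleftrightarrow> A" "0 < num a' * num b' \<longleftrightarrow> A'"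
    "num a * den a' < num a' * den a \<longleftrightarrow> C" "num a' * den a < num a * den a' \<longleftrightarrow> C'"
    "num b * den b' < num b' * den b \<longleftrightarrow> D"
    "(num a * den b + num b * den a) * (den a' * den b') < (num a' * den b' + num b' * den a') * (den a * den b) \<longleftrightarrow> E"
    by (simp_all only: A_def A'_def C_def C'_def D_def E_def both_pos_iff assms flip: rat_less_iff rat_add_less_iff)
  have worse: "worse a b a' b' \<longleftrightarrow> (if A then A' \<and> (C \<or> \<not> C' \<and> D) else A' \<or> E)"
    by (auto simp: worse_def A_def A'_def C_def C'_def D_def E_def)
  show ?thesis
    unfolding returns_def prog_simps less_body_def Let_def
    by (cases A; cases A'; cases C; cases C'; cases D; cases E;
       simp add: wp_simps encode_rat_eq tests worse;
       rule order_trans, (rule cost_intros Suc_le_mono[THEN iffD2] sh' | rule le_refl)+;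
       use LL in \<open>simp only: distrib_left distrib_right\<close>)
qed

section \<open>Correctness and cost of the functions of the program\<close>

locale smc_program =
  fixes n L :: nat and U V :: "nat \<Rightarrow> nat \<Rightarrow> rat"
  assumes inst: "smc_instance n U V" and L: "2 \<le> L"
    and short: "m < n \<Longrightarrow> w < n \<Longrightarrow> short L (U m w)" "m < n \<Longrightarrow> w < n \<Longrightarrow> short L (V m w)"
    and index: "k \<le> n \<Longrightarrow> int_size (int k) \<le> L"
begin

sublocale preferences n "\<lambda>m w w'. worse (U m w) (V m w) (U m w') (V m w')"
  "\<lambda>w m m'. worse (V m w) (U m w) (V m' w) (U m' w)"
  by unfold_locales (fact worse_asym not_worse_trans)+

definition enc_cand :: "nat \<Rightarrow> nat \<Rightarrow> val" where
  "enc_cand m w = PairV (IntV (int w)) (PairV (encode_rat (U m w)) (encode_rat (V m w)))"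

definition enc_man :: "nat \<times> nat list \<Rightarrow> val" where
  "enc_man e = PairV (IntV (int (fst e))) (encode_list (map (enc_cand (fst e)) (snd e)))"

definition enc_men :: "(nat \<times> nat list) list \<Rightarrow> val" where
  "enc_men es = encode_list (map enc_man es)"

lemma encode_list_simps [simp]:
  "encode_list [] = IntV 0" "encode_list (x # xs) = PairV x (encode_list xs)"
  by (simp_all add: encode_list_def)

lemma enc_men_simps [simp]: "enc_men [] = IntV 0" "enc_men (e # es) = PairV (enc_man e) (enc_men es)"
  by (simp_all add: enc_men_def)

lemma pair_case_enc [simp]:
  "pair_case (enc_man e) Q = Q (IntV (int (fst e))) (encode_list (map (enc_cand (fst e)) (snd e)))"
  "pair_case (enc_cand m w) Q = Q (IntV (int w)) (PairV (encode_rat (U m w)) (encode_rat (V m w)))"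
  by (simp_all add: enc_man_def enc_cand_def)

text \<open>Pays for one comparison together with the overhead of a recursive call, so that the
  bounds below count loop iterations.\<close>

definition unit_time :: nat where "unit_time = 1000 * (L * L)"

lemma unit_time: "500 * (L * L) + 100 * L + 200 \<le> unit_time"
proof -
  have "2 * L \<le> L * L" using L by simp
  then show ?thesis using L unfolding unit_time_def by linarith
qed

lemma man_less_returns:
  assumes "m < n" "w < n" "w' < n"
  shows "returns prog (Suc 0)
    [PairV (encode_rat (U m w)) (encode_rat (V m w)), PairV (encode_rat (U m w')) (encode_rat (V m w'))]
    (IntV (if worse (U m w) (V m w) (U m w') (V m w') then 1 else 0)) (500 * (L * L))"
  using assms inst less_returns[OF _ _ _ _ L] short by (simp add: smc_instance_def)

lemma woman_less_returns:
  assumes "w < n" "m < n" "m' < n"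
  shows "returns prog (Suc 0)
    [PairV (encode_rat (V m w)) (encode_rat (U m w)), PairV (encode_rat (V m' w)) (encode_rat (U m' w))]
    (IntV (if worse (V m w) (U m w) (V m' w) (U m' w) then 1 else 0)) (500 * (L * L))"
  using assms inst less_returns[OF _ _ _ _ L] short by (simp add: smc_instance_def)

lemma best_first_returns:
  assumes "m < n" "set cs \<subseteq> {..<n}"
  shows "returns prog 2 [encode_list (map (enc_cand m) cs)]
    (encode_list (map (enc_cand m) (best_first m cs))) (Suc (length cs) * unit_time)"
  using assms(2)
proof (induction cs)
  case Nil
  show ?case using unit_time by (simp add: returns_def prog_simps best_body_def wp_simps)
next
  case (Cons x xs)
  then have IH: "returns prog 2 [encode_list (map (enc_cand m) xs)]
    (encode_list (map (enc_cand m) (best_first m xs))) (Suc (length xs) * unit_time)" and x: "x < n"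
    by auto
  show ?case
  proof (cases "best_first m xs")
    case Nil
    then have "xs = []" by simp
    show ?thesis
      unfolding returns_def prog_simps best_body_def
      apply (simp add: wp_simps)
      apply (rule wpf_returns[OF IH])
      using unit_time \<open>xs = []\<close> apply (simp add: wp_simps)
      done
  next
    case (Cons b r)
    then have "b \<in> set (best_first m xs)" by simp
    then have "b < n" using Cons.prems by auto
    show ?thesis
      unfolding returns_def prog_simps best_body_def
      apply (simp add: wp_simps)
      apply (rule wpf_returns[OF IH])
      apply (cases "worse (U m b) (V m b) (U m x) (V m x)";
          simp add: Cons wp_simps enc_cand_def;
          rule wpf_returns[OF man_less_returns[OF assms(1) \<open>b < n\<close> x]];
          use unit_time in simp)
      done
  qed
qed

lemma sq_pos_iff: "0 < (i - j) * (i - j) \<longleftrightarrow> i \<noteq> (j :: int)"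
  by (simp add: zero_less_mult_iff) linarith

lemma sq_cost:
  assumes "int_size i \<le> L" "int_size j \<le> L"
  shows "int_size (i - j) \<le> 2 * L" "int_size ((i - j) * (i - j)) \<le> 4 * L"
    "int_size (i - j) * int_size (i - j) \<le> 4 * (L * L)" "int_size i * int_size j \<le> L * L"
proof -
  show 1: "int_size (i - j) \<le> 2 * L" using int_size_diff_le[OF assms] by simp
  show "int_size ((i - j) * (i - j)) \<le> 4 * L" using int_size_mult_le[OF 1 1] by simp
  show "int_size (i - j) * int_size (i - j) \<le> 4 * (L * L)" using mult_le_mono[OF 1 1] by simp
  show "int_size i * int_size j \<le> L * L" using mult_le_mono[OF assms] .
qed

text \<open>The part of the invariant that speaks of one man alone, which suits induction along a
  list.\<close>

definition valid :: "nat \<times> nat list \<Rightarrow> bool" where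
  "valid e \<longleftrightarrow> fst e < n \<and> snd e \<noteq> [] \<and> set (snd e) \<subseteq> {..<n}"

definition enc_loser :: "(nat \<times> nat list) option \<Rightarrow> val" where
  "enc_loser l = (case l of None \<Rightarrow> IntV 0 | Some e \<Rightarrow> enc_man e)"

lemma propose_returns:
  assumes "valid e" "\<And>f. f \<in> set es \<Longrightarrow> valid f"
  shows "returns prog 3 [enc_man e, enc_men es]
    (case propose e es of (es', l) \<Rightarrow> PairV (enc_men es') (enc_loser l)) (Suc (length es) * unit_time)"
  using assms(2)
proof (induction es)
  case Nil
  show ?case using unit_time
    by (simp add: returns_def prog_simps propose_body_def wp_simps enc_men_def enc_loser_def)
next
  case (Cons f es)
  obtain m w r where e: "e = (m, w # r)" and mw: "m < n" "w < n"
    using assms(1) by (cases e; cases "snd e") (auto simp: valid_def)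
  have "valid f" using Cons.prems by simp
  then obtain m' w' r' where f: "f = (m', w' # r')" and mw': "m' < n" "w' < n"
    by (cases f; cases "snd f") (auto simp: valid_def)
  \<comment> \<open>The second instance serves the case \<open>w = w'\<close>.\<close>
  note cost = sq_cost[OF index[OF less_imp_le[OF mw(2)]] index[OF less_imp_le[OF mw'(2)]]]
    sq_cost[OF index[OF less_imp_le[OF mw'(2)]] index[OF less_imp_le[OF mw'(2)]]]
  obtain es' l where p: "propose e es = (es', l)" by force
  have IH: "returns prog 3 [enc_man e, enc_men es] (PairV (enc_men es') (enc_loser l))
      (Suc (length es) * unit_time)"
    using Cons p by simp
  show ?case
  proof (cases "w = w'")
    case False
    then have "propose e (f # es) = (f # es', l)" using p by (simp add: e f head_def)
    moreover have "returns prog 3 [enc_man e, enc_men (f # es)]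
      (PairV (enc_men (f # es')) (enc_loser l)) (Suc (length (f # es)) * unit_time)"
      unfolding returns_def prog_simps propose_body_def Let_def sq_def
      apply (simp add: wp_simps f e sq_pos_iff False)
      apply (rule wpf_returns[OF IH[unfolded e]])
      using unit_time cost apply (simp add: wp_simps)
      done
    ultimately show ?thesis by simp
  next
    case True
    show ?thesis
      unfolding returns_def prog_simps propose_body_def Let_def sq_def
      apply (cases "worse (V m' w') (U m' w') (V m w') (U m w')";
          simp add: wp_simps e f True sq_pos_iff head_def;
          rule wpf_returns[OF woman_less_returns[OF \<open>w' < n\<close> \<open>m' < n\<close> \<open>m < n\<close>]];
          use unit_time cost in \<open>simp add: enc_loser_def reject_def enc_man_def\<close>)
      done
  qed
qed

lemma case_enc_man [simp]:
  "(case enc_man e of IntV i \<Rightarrow> f i | PairV x y \<Rightarrow> g x y) =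
    g (IntV (int (fst e))) (encode_list (map (enc_cand (fst e)) (snd e)))"
  by (simp add: enc_man_def)

text \<open>Induction on \<open>gs_steps\<close>, which drops with every proposal. A round selects
  among at most \<open>n\<close> candidates and scans at most \<open>n\<close> engaged men; the
  factor 3 gives one share to each of these and one to the overhead.\<close>

lemma gs_returns:
  assumes "gs_inv free es"
  shows "\<exists>es'. gs_inv [] es' \<and> returns prog 4 [enc_men free, enc_men es] (enc_men es')
    (Suc (gs_steps free es) * (3 * (Suc n * unit_time)))"
  using assms
proof (induction "gs_steps free es" arbitrary: free es rule: less_induct)
  case less
  let ?u = "Suc n * unit_time"
  have u: "unit_time \<le> ?u" by simp
  show ?case
  proof (cases free)
    case Nil
    have "returns prog 4 [enc_men free, enc_men es] (enc_men es) (3 * ?u)"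
      using unit_time u by (simp add: returns_def prog_simps gs_body_def wp_simps Nil)
    then have "returns prog 4 [enc_men free, enc_men es] (enc_men es) (Suc (gs_steps free es) * (3 * ?u))"
      by (rule returns_mono) simp
    then show ?thesis using less.prems Nil by blast
  next
    case (Cons e free1)
    obtain m cs where e: "e = (m, cs)" by force
    obtain es1 l where p: "propose (m, best_first m cs) es = (es1, l)" by force
    define free' where "free' = (case l of None \<Rightarrow> free1 | Some e \<Rightarrow> e # free1)"
    have inv: "gs_inv ((m, cs) # free1) es" using less.prems Cons e by simp
    note step = gs_inv_step[OF inv p free'_def]
    from less.hyps[OF _ step(1)] step(2) obtain es' where fin: "gs_inv [] es'"
      and IH: "returns prog 4 [enc_men free', enc_men es1] (enc_men es') (Suc (gs_steps free' es1) * (3 * ?u))"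
      unfolding Cons e by blast
    have m: "m < n" and cs: "set cs \<subseteq> {..<n}" "length cs \<le> n"
      using inv by (auto simp: gs_inv_def settled_def)
    have "valid (m, best_first m cs)"
      using m cs gs_inv_candidates[OF inv] by (simp add: valid_def)
    moreover have "valid f" if "f \<in> set es" for f
      using inv that by (auto simp: gs_inv_def settled_def engaged_def valid_def)
    ultimately have P: "returns prog 3 [enc_man (m, best_first m cs), enc_men es]
        (PairV (enc_men es1) (enc_loser l)) (Suc (length es) * unit_time)"
      using propose_returns[of "(m, best_first m cs)" es] p by simp
    have "Suc (length cs) * unit_time \<le> ?u" using cs by simp
    moreover have "Suc (length es) * unit_time \<le> ?u"
      using gs_inv_length[OF inv] by (intro mult_le_mono) auto
    moreover have "Suc (gs_steps free' es1) * (3 * ?u) + 3 * ?u \<le> Suc (gs_steps free es) * (3 * ?u)"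
      using mult_le_mono1[of "Suc (Suc (gs_steps free' es1))" "Suc (gs_steps free es)" "3 * ?u"]
        step(2) by (simp add: Cons e)
    ultimately have bounds: "s + t + r + 100 \<le> Suc (gs_steps free es) * (3 * ?u)"
      if "s \<le> Suc (length cs) * unit_time" "t \<le> Suc (length es) * unit_time"
        "r \<le> Suc (gs_steps free' es1) * (3 * ?u)" for s t r
      using that unit_time u by linarith
    have "returns prog 4 [enc_men free, enc_men es] (enc_men es') (Suc (gs_steps free es) * (3 * ?u))"
      unfolding returns_def prog_simps gs_body_def Cons e
      apply (simp only: wp_simps)
      apply (simp del: mult_Suc)
      apply (rule wpf_returns[OF best_first_returns[OF m cs(1)]])
      apply (rule wpf_returns[OF P[unfolded enc_man_def fst_conv snd_conv]])
      subgoal premises times for s t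
      proof (cases l)
        case None
        have "returns prog 4 [enc_men free1, enc_men es1] (enc_men es') (Suc (gs_steps free' es1) * (3 * ?u))"
          using IH by (simp only: free'_def None option.case)
        note call = wpf_returns[OF this]
        show ?thesis
          apply (simp add: None enc_loser_def del: mult_Suc)
          apply (rule call)
          subgoal for r using bounds[OF times, of r] by (simp add: Cons e del: mult_Suc)
          done
      next
        case (Some f)
        have "returns prog 4 [PairV (enc_man f) (enc_men free1), enc_men es1] (enc_men es')
            (Suc (gs_steps free' es1) * (3 * ?u))"
          using IH by (simp only: free'_def Some option.case enc_men_simps)
        note call = wpf_returns[OF this]
        show ?thesis
          apply (simp add: Some enc_loser_def del: mult_Suc)
          apply (rule call)
          subgoal for r using bounds[OF times, of r] by (simp add: Cons e del: mult_Suc)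
          done
      qed
      done
    then show ?thesis using fin by blast
  qed
qed

lemma candidates_returns:
  assumes "m < n" "j \<le> n"
  shows "returns prog 5
    [encode_list (map (\<lambda>w. encode_rat (U m w)) [j..<n]),
     encode_list (map (\<lambda>w. encode_rat (V m w)) [j..<n]), IntV (int j)]
    (encode_list (map (enc_cand m) [j..<n])) (Suc (n - j) * unit_time)"
  using assms(2)
proof (induction rule: inc_induct)
  case base
  show ?case using unit_time by (simp add: returns_def prog_simps candidates_body_def wp_simps)
next
  case (step j)
  have [simp]: "[j..<n] = j # [Suc j..<n]" using step.hyps by (simp add: upt_conv_Cons)
  have IH: "returns prog 5 [encode_list (map (\<lambda>w. encode_rat (U m w)) [Suc j..<n]),
     encode_list (map (\<lambda>w. encode_rat (V m w)) [Suc j..<n]), IntV (int j + 1)]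
    (encode_list (map (enc_cand m) [Suc j..<n])) (Suc (n - Suc j) * unit_time)"
    using step.IH by (simp add: add.commute)
  have "Suc (n - j) = Suc (Suc (n - Suc j))" using step.hyps by simp
  then show ?case
    unfolding returns_def prog_simps candidates_body_def
    using index[of j] step.hyps
    apply (simp add: wp_simps)
    apply (rule wpf_returns[OF IH])
    using unit_time apply (simp add: enc_cand_def)
    done
qed

lemma men_returns:
  assumes "i \<le> n"
  shows "returns prog 6
    [encode_list (map (\<lambda>m. encode_list (map (\<lambda>w. encode_rat (U m w)) [0..<n])) [i..<n]),
     encode_list (map (\<lambda>m. encode_list (map (\<lambda>w. encode_rat (V m w)) [0..<n])) [i..<n]), IntV (int i)]
    (enc_men (map (\<lambda>m. (m, [0..<n])) [i..<n])) (Suc (n - i) * ((n + 2) * unit_time))"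
  using assms
proof (induction rule: inc_induct)
  case base
  show ?case using unit_time by (simp add: returns_def prog_simps men_body_def wp_simps)
next
  case (step i)
  let ?E = "\<lambda>X m. encode_list (map (\<lambda>w. encode_rat (X m w)) [0..<n])"
  have *: "[i..<n] = i # [Suc i..<n]" using step.hyps by (simp add: upt_conv_Cons)
  have IH: "returns prog 6 [encode_list (map (?E U) [Suc i..<n]), encode_list (map (?E V) [Suc i..<n]), IntV (int i + 1)]
    (enc_men (map (\<lambda>m. (m, [0..<n])) [Suc i..<n])) (Suc (n - Suc i) * ((n + 2) * unit_time))"
    using step.IH by (simp add: add.commute)
  have C: "returns prog 5 [?E U i, ?E V i, IntV 0]
    (encode_list (map (enc_cand i) [0..<n])) (Suc n * unit_time)"
    using candidates_returns[of i 0] step.hyps by simp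
  have "Suc (n - i) = Suc (Suc (n - Suc i))" using step.hyps by simp
  then show ?case
    unfolding returns_def prog_simps men_body_def *
    using index[of i] step.hyps
    apply (simp add: wp_simps del: upt_Suc)
    apply (rule wpf_returns[OF C])
    apply (simp add: wp_simps)
    apply (rule wpf_returns[OF IH])
    using unit_time apply (simp add: enc_man_def)
    done
qed

end

section \<open>Writing out the matching as a 0/1 matrix\<close>

context smc_program
begin

definition matched :: "(nat \<times> nat list) list \<Rightarrow> nat \<Rightarrow> nat \<Rightarrow> rat" where
  "matched es m w = (if \<exists>e\<in>set es. fst e = m \<and> head e = w then 1 else 0)"

lemma cell_returns:
  assumes "i < n" "j < n" "\<And>e. e \<in> set es \<Longrightarrow> valid e"
  shows "returns prog 7 [IntV (int i), IntV (int j), enc_men es] (encode_rat (matched es i j))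
    (Suc (length es) * unit_time)"
  using assms(3)
proof (induction es)
  case Nil
  show ?case using unit_time
    by (simp add: returns_def prog_simps cell_body_def wp_simps matched_def encode_rat_def)
next
  case (Cons e es)
  have "valid e" using Cons.prems by simp
  then obtain m w r where e: "e = (m, w # r)" and mw: "m < n" "w < n"
    by (cases e; cases "snd e") (auto simp: valid_def)
  have IH: "returns prog 7 [IntV (int i), IntV (int j), enc_men es] (encode_rat (matched es i j))
    (Suc (length es) * unit_time)"
    using Cons by simp
  note cost = sq_cost[OF index[OF less_imp_le[OF assms(1)]] index[OF less_imp_le[OF mw(1)]]]
    sq_cost[OF index[OF less_imp_le[OF assms(2)]] index[OF less_imp_le[OF mw(2)]]]
  \<comment> \<open>\<open>cost(2)\<close> and \<open>cost(6)\<close> bound the sizes of the two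
    squares by \<open>4 * L\<close>.\<close>
  have sum_cost: "int_size ((int i - int m) * (int i - int m) + (int j - int w) * (int j - int w)) \<le> 8 * L"
    using int_size_add_le[OF cost(2) cost(6)] by simp
  have prod_cost: "int_size ((int i - int m) * (int i - int m)) * int_size ((int j - int w) * (int j - int w))
      \<le> 16 * (L * L)"
    using mult_le_mono[OF cost(2) cost(6)] by simp
  have test: "0 < (int i - int m) * (int i - int m) + (int j - int w) * (int j - int w) \<longleftrightarrow> \<not> (i = m \<and> j = w)"
    by (simp add: sum_squares_gt_zero_iff)
  show ?case
  proof (cases "i = m \<and> j = w")
    case True
    then show ?thesis
      unfolding returns_def prog_simps cell_body_def sq_def
      using unit_time cost sum_cost prod_cost
      by (simp add: wp_simps e matched_def head_def encode_rat_def)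
  next
    case False
    then have *: "matched (e # es) i j = matched es i j" by (auto simp: matched_def e head_def)
    show ?thesis
      unfolding returns_def prog_simps cell_body_def sq_def *
      apply (simp add: wp_simps e test False)
      apply (rule wpf_returns[OF IH])
      using unit_time cost sum_cost prod_cost apply simp
      done
  qed
qed

text \<open>A cell costs at most \<open>Suc n\<close> units, for the scan of the engaged men; the
  remaining unit of \<open>n + 2\<close> pays for the loop.\<close>

lemma row_returns:
  assumes "i < n" "\<And>e. e \<in> set es \<Longrightarrow> valid e" "length es \<le> n" "j \<le> n"
  shows "returns prog 8 [IntV (int i), IntV (int j), IntV (int n), enc_men es]
    (encode_list (map (\<lambda>j. encode_rat (matched es i j)) [j..<n])) (Suc (n - j) * ((n + 2) * unit_time))"
  using assms(4)
proof (induction rule: inc_induct)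
  case base
  show ?case using unit_time mult_le_mono[OF index[of n] index[of n]]
    by (simp add: returns_def prog_simps row_body_def wp_simps)
next
  case (step j)
  have [simp]: "[j..<n] = j # [Suc j..<n]" using step.hyps by (simp add: upt_conv_Cons)
  have IH: "returns prog 8 [IntV (int i), IntV (int j + 1), IntV (int n), enc_men es]
    (encode_list (map (\<lambda>j. encode_rat (matched es i j)) [Suc j..<n])) (Suc (n - Suc j) * ((n + 2) * unit_time))"
    using step.IH by (simp add: add.commute)
  have "Suc (length es) * unit_time \<le> Suc n * unit_time"
    using assms(3) by (intro mult_le_mono) auto
  then have C: "returns prog 7 [IntV (int i), IntV (int j), enc_men es] (encode_rat (matched es i j))
      (Suc n * unit_time)"
    using cell_returns[OF assms(1) step.hyps(2) assms(2)] by (rule returns_mono[rotated])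
  have "Suc (n - j) = Suc (Suc (n - Suc j))" using step.hyps by simp
  then show ?case
    unfolding returns_def prog_simps row_body_def
    using step.hyps
    apply (simp add: wp_simps)
    apply (rule wpf_returns[OF C])
    apply (simp add: wp_simps)
    apply (rule wpf_returns[OF IH])
    using unit_time index[of j] mult_le_mono[OF index[of j] index[of n]] apply simp
    done
qed

lemma matrix_returns:
  assumes "\<And>e. e \<in> set es \<Longrightarrow> valid e" "length es \<le> n" "i \<le> n"
  shows "returns prog 9 [IntV (int i), IntV (int n), enc_men es]
    (encode_list (map (\<lambda>i. encode_list (map (\<lambda>j. encode_rat (matched es i j)) [0..<n])) [i..<n]))
    (Suc (n - i) * ((n + 2) * (n + 2) * unit_time))"
  using assms(3)
proof (induction rule: inc_induct)
  case base
  show ?case using unit_time mult_le_mono[OF index[of n] index[of n]]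
    by (simp add: returns_def prog_simps matrix_body_def wp_simps)
next
  case (step i)
  have *: "[i..<n] = i # [Suc i..<n]" using step.hyps by (simp add: upt_conv_Cons)
  let ?R = "\<lambda>i. encode_list (map (\<lambda>j. encode_rat (matched es i j)) [0..<n])"
  have IH: "returns prog 9 [IntV (int i + 1), IntV (int n), enc_men es]
    (encode_list (map ?R [Suc i..<n])) (Suc (n - Suc i) * ((n + 2) * (n + 2) * unit_time))"
    using step.IH by (simp add: add.commute)
  have C: "returns prog 8 [IntV (int i), IntV 0, IntV (int n), enc_men es] (?R i)
      (Suc n * ((n + 2) * unit_time))"
    using row_returns[OF step.hyps(2) assms(1,2), of 0] by simp
  have "Suc (n - i) = Suc (Suc (n - Suc i))" using step.hyps by simp
  then show ?case
    unfolding returns_def prog_simps matrix_body_def *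
    using step.hyps
    apply (simp add: wp_simps)
    apply (rule wpf_returns[OF C])
    apply (simp add: wp_simps)
    apply (rule wpf_returns[OF IH])
    using unit_time index[of i] mult_le_mono[OF index[of i] index[of n]] apply (simp add: distrib_left distrib_right)
    done
qed

lemma main_returns:
  "\<exists>es. gs_inv [] es \<and> returns prog 0 [encode_instance n U V] (encode_matrix n (matched es))
    (6 * ((n + 2) * (n + 2) * (n + 2) * unit_time))"
proof -
  let ?free = "map (\<lambda>m. (m, [0..<n])) [0..<n]"
  obtain es where es: "gs_inv [] es" and G: "returns prog 4 [enc_men ?free, IntV 0] (enc_men es)
    (Suc (gs_steps ?free []) * (3 * (Suc n * unit_time)))"
    using gs_returns[OF gs_inv_init] by auto
  \<comment> \<open>Initially all \<open>n\<close> men are free, each with a list of all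
    \<open>n\<close> women.\<close>
  have steps: "gs_steps ?free [] = n * n + n"
    by (simp add: gs_steps_def comp_def sum_list_triv)
  have valid: "valid e" if "e \<in> set es" for e
    using es that by (auto simp: gs_inv_def settled_def engaged_def valid_def)
  have M: "returns prog 6 [encode_matrix n U, encode_matrix n V, IntV 0] (enc_men ?free)
    (Suc n * ((n + 2) * unit_time))"
    using men_returns[where i = 0] by (simp add: encode_matrix_def)
  have O: "returns prog 9 [IntV 0, IntV (int n), enc_men es] (encode_matrix n (matched es))
    (Suc n * ((n + 2) * (n + 2) * unit_time))"
    using matrix_returns[OF valid, where i = 0] gs_inv_length[OF es] by (simp add: encode_matrix_def)
  have "returns prog 0 [encode_instance n U V] (encode_matrix n (matched es))
    (6 * ((n + 2) * (n + 2) * (n + 2) * unit_time))"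
    unfolding returns_def prog_simps main_body_def encode_instance_def
    apply (simp add: wp_simps)
    apply (rule wpf_returns[OF M])
    apply (simp add: wp_simps)
    apply (rule wpf_returns[OF G])
    apply (simp add: wp_simps)
    apply (rule wpf_returns[OF O])
    using unit_time apply (simp add: steps distrib_left distrib_right)
    done
  then show ?thesis using es by blast
qed

end

section \<open>Input size and the final bound\<close>

lemma encode_list_size: "length vs \<le> val_size (encode_list vs)"
  and encode_list_member_size: "v \<in> set vs \<Longrightarrow> val_size v \<le> val_size (encode_list vs)"
  by (induction vs) (auto simp: encode_list_def)

lemma encode_matrix_size: "n \<le> val_size (encode_matrix n A)"
  using encode_list_size[of "map (\<lambda>i. encode_list (map (\<lambda>j. encode_rat (A i j)) [0..<n])) [0..<n]"]
  by (simp add: encode_matrix_def)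

lemma encode_matrix_short:
  assumes "m < n" "w < n"
  shows "short (val_size (encode_matrix n A)) (A m w)"
proof -
  let ?row = "map (\<lambda>j. encode_rat (A m j)) [0..<n]"
  have "val_size (encode_rat (A m w)) \<le> val_size (encode_list ?row)"
    by (rule encode_list_member_size) (use assms in auto)
  also have "\<dots> \<le> val_size (encode_matrix n A)"
    unfolding encode_matrix_def by (rule encode_list_member_size) (use assms in auto)
  finally show ?thesis by (simp add: short_def encode_rat_eq)
qed

text \<open>Every numerator and denominator is a leaf of the encoded input, and so is
  \<open>n\<close>. The input size thus bounds the bit lengths of all entries and indices.\<close>

lemma smc_program_instance:
  assumes "smc_instance n U V"
  shows "smc_program n (val_size (encode_instance n U V)) U V"
proof
  show "smc_instance n U V" by fact
  show "2 \<le> val_size (encode_instance n U V)" by (simp add: encode_instance_def)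
  show "short (val_size (encode_instance n U V)) (U m w)" if "m < n" "w < n" for m w
    using encode_matrix_short[OF that, of U] by (simp add: short_def encode_instance_def)
  show "short (val_size (encode_instance n U V)) (V m w)" if "m < n" "w < n" for m w
    using encode_matrix_short[OF that, of V] by (simp add: short_def encode_instance_def)
  show "int_size (int k) \<le> val_size (encode_instance n U V)" if "k \<le> n" for k
    using int_size_mono[OF that] by (simp add: encode_instance_def)
qed

text \<open>Allows \<open>matched es\<close> to be replaced by \<open>perm_matrix \<sigma>\<close>,
  with which it is known to agree only on indices below \<open>n\<close>.\<close>

lemma encode_matrix_cong:
  "(\<And>i j. i < n \<Longrightarrow> j < n \<Longrightarrow> A i j = B i j) \<Longrightarrow> encode_matrix n A = encode_matrix n B"
  unfolding encode_matrix_def by (intro arg_cong[where f = encode_list] map_cong refl) auto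

text \<open>The ratios are stated against every complete matching, in particular against an optimal
  one.\<close>

lemma prog_solution:
  assumes inst: "smc_instance n U V"
  shows "\<exists>A t. runs prog (encode_instance n U V) (encode_matrix n A) t \<and>
    t \<le> 48002 * val_size (encode_instance n U V) ^ 5 \<and>
    (let \<mu> = (\<lambda>m w. real_of_rat (A m w)) in
      complete_matching n \<mu> \<and> integral_matching n \<mu> \<and> stable_matching n U V \<mu> \<and>
      (\<forall>\<nu>. complete_matching n \<nu> \<longrightarrow>
        (\<forall>\<alpha>>1. ternary_valuations \<alpha> n U V \<longrightarrow>
          min (1 / 2) (1 / \<alpha>) * welfare n U V \<nu> \<le> welfare n U V \<mu>) \<and>
        (nonzero_valuations n U V \<noteq> {} \<longrightarrow>
          inverse (1 + real_of_rat (sigma_max n U V) / real_of_rat (sigma_min n U V))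
            * welfare n U V \<nu> \<le> welfare n U V \<mu>)))"
proof -
  let ?N = "val_size (encode_instance n U V)"
  interpret smc_program n ?N U V using inst by (rule smc_program_instance)
  obtain es where es: "gs_inv [] es" and ret: "returns prog 0 [encode_instance n U V]
      (encode_matrix n (matched es)) (6 * ((n + 2) * (n + 2) * (n + 2) * unit_time))"
    using main_returns by blast
  show ?thesis
  proof (rule gs_inv_final[OF es])
    fix \<sigma> \<tau>
    assume st: "\<And>m. m < n \<Longrightarrow> \<sigma> m < n" "\<And>w. w < n \<Longrightarrow> \<tau> w < n"
      "\<And>m. m < n \<Longrightarrow> \<tau> (\<sigma> m) = m" "\<And>w. w < n \<Longrightarrow> \<sigma> (\<tau> w) = w"
      "\<And>m w. m < n \<Longrightarrow> w < n \<Longrightarrow>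
        \<not> worse (U m (\<sigma> m)) (V m (\<sigma> m)) (U m w) (V m w) \<or>
        \<not> worse (V (\<tau> w) w) (U (\<tau> w) w) (V m w) (U m w)"
      "\<And>m w. m < n \<Longrightarrow> (\<exists>e\<in>set es. fst e = m \<and> head e = w) \<longleftrightarrow> \<sigma> m = w"
    interpret stable_permutation n U V \<sigma> \<tau>
      by unfold_locales (use inst st in auto)
    have "encode_matrix n (matched es) = encode_matrix n (perm_matrix \<sigma>)"
      by (rule encode_matrix_cong) (simp add: matched_def perm_matrix_def st(6))
    note ret' = ret[unfolded this]
    \<comment> \<open>The added 2 pays for the initial call and its argument.\<close>
    have "wp prog [encode_instance n U V] (Call 0 [Var 0]) (\<lambda>v t. v = encode_matrix n (perm_matrix \<sigma>) \<and>
        t \<le> 6 * ((n + 2) * (n + 2) * (n + 2) * unit_time) + 2)"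
      apply (simp add: wp_simps)
      apply (rule wpf_returns[OF ret'])
      apply simp
      done
    then obtain t where
      run: "runs prog (encode_instance n U V) (encode_matrix n (perm_matrix \<sigma>)) t"
      and t: "t \<le> 6 * ((n + 2) * (n + 2) * (n + 2) * unit_time) + 2"
      unfolding wp_def runs_def by blast
    have N: "n + 2 \<le> 2 * ?N" "1 \<le> ?N"
      using encode_matrix_size[of n U] L by (simp_all add: encode_instance_def)
    have "t \<le> 6 * ((n + 2) * (n + 2) * (n + 2) * (1000 * (?N * ?N))) + 2 * 1"
      using t by (simp add: unit_time_def)
    \<comment> \<open>Three factors \<open>n + 2\<close> and the square in \<open>unit_time\<close>
      give the fifth power; the constant is \<open>6 * 8 * 1000 + 2\<close>.\<close>
    also have "\<dots> \<le> 6 * ((2 * ?N) * (2 * ?N) * (2 * ?N) * (1000 * (?N * ?N))) + 2 * ?N ^ 5"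
      using N by (intro add_mono mult_le_mono order_refl one_le_power)
    also have "\<dots> = 48002 * ?N ^ 5"
      by (simp add: power_numeral_reduce)
    finally have "t \<le> 48002 * ?N ^ 5" .
    with run show ?thesis
      using complete integral stable ternary_ratio general_ratio
      by (intro exI[of _ "perm_matrix \<sigma>"] exI[of _ t]) (auto simp: Let_def)
  qed
qed

theorem theorem5:
  "\<exists>P. poly_time_solves P
     (\<lambda>(n, U, V). encode_instance n U V)
     (\<lambda>(n, U, V) A. encode_matrix n A)
     (\<lambda>(n, U, V). smc_instance n U V)
     (\<lambda>(n, U, V) A.
        let \<mu> = (\<lambda>m w. real_of_rat (A m w)) in
          complete_matching n \<mu> \<and> integral_matching n \<mu> \<and> stable_matching n U V \<mu> \<and>
          (\<forall>\<mu>opt. optimal_matching n U V \<mu>opt \<longrightarrow>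
             (\<forall>\<alpha>>1. ternary_valuations \<alpha> n U V \<longrightarrow>
                welfare n U V \<mu> \<ge> min (1 / 2) (1 / \<alpha>) * welfare n U V \<mu>opt) \<and>
             (nonzero_valuations n U V \<noteq> {} \<longrightarrow>
                welfare n U V \<mu> \<ge>
                  inverse (1 + real_of_rat (sigma_max n U V) / real_of_rat (sigma_min n U V))
                    * welfare n U V \<mu>opt)))"
proof (intro exI[of _ prog], unfold poly_time_solves_def,
    intro exI[of _ "monom 48002 5"] allI impI, goal_cases)
  case (1 x)
  obtain n U V where x: "x = (n, U, V)" by (cases x)
  with 1 have "smc_instance n U V" by simp
  from prog_solution[OF this] show ?case
    by (simp add: x poly_monom Let_def optimal_matching_def) blast
qed

end
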